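(* Let $p$ be a prime number and $n\ge 1$. The actions of the Hecke correspondences $T_{p^k}$ on $\mathbb{Z}\lambda(\mathrm{SL}_2(\mathbb{Z}))$ satisfy $$T_{p^n}\circ T_p=T_{p^{n+1}}+T_{p^{n-1}}\circ \mathbf{e}_p .$$
   Context: For a group $\Gamma$, $\lambda(\Gamma)$ is its set of conjugacy classes and $\mathbb{Z}\lambda(\Gamma)$ the free abelian group on $\lambda(\Gamma)$. A homomorphism $\psi:\Gamma\to\Gamma'$ induces $\psi_*:\mathbb{Z}\lambda(\Gamma)\to\mathbb{Z}\lambda(\Gamma')$. If $\pi:\Gamma'\hookrightarrow\Gamma$ is the inclusion of a finite index subgroup, the pullback $\pi^*:\mathbb{Z}\lambda(\Gamma)\to\mathbb{Z}\lambda(\Gamma')$ sends the class of $\alpha$ to $\sum_{s}[\gamma_s\alpha^{d_s}\gamma_s^{-1}]$, where $s$ ranges over $\Gamma'\backslash\Gamma/\langle\alpha\rangle$, $\gamma_s$ is a representative of $s$, and $d_s=\min\{k>0:\gamma_s\alpha^k\gamma_s^{-1}\in\Gamma'\}$. The Hecke correspondence $T_N$ is the correspondence $\mathcal{M}_{1,1}\xleftarrow{\pi_N}\mathrm{Cov}_N\xrightarrow{\pi_N^{op}}\mathcal{M}_{1,1}$, where $\mathcal{M}_{1,1}=\mathrm{SL}_2(\mathbb{Z})\backslash\mathfrak{h}$ is the orbifold of lattices in $\mathbb{C}$ modulo scaling, $\mathrm{Cov}_N$ is the orbifold of pairs $(\Lambda\supset\Lambda')$ of lattices with $[\Lambda:\Lambda']=N$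 modulo scaling, $\pi_N(\Lambda,\Lambda')=\Lambda$, $\pi_N^{op}(\Lambda,\Lambda')=\Lambda'$; the induced operator is $T_N=(\pi_N^{op})_*\circ\pi_N^*$ (summing over connected components). Concretely: let $\mathrm{SL}_2(\mathbb{Z})$ act on row vectors $\mathbb{Z}^2$ on the right. For an index $N$ sublattice $L\subset\mathbb{Z}^2$ let $\Gamma_L=\{\gamma:L\gamma=L\}$ with inclusion $\pi_L$ into $\mathrm{SL}_2(\mathbb{Z})$, choose an integer matrix $A_L$ with $\det A_L=N$, $L=\mathbb{Z}^2A_L$, and let $\psi_L:\Gamma_L\to\mathrm{SL}_2(\mathbb{Z})$, $\gamma\mapsto A_L\gamma A_L^{-1}$. Then $T_N=\sum_L(\psi_L)_*\circ\pi_L^*$, $L$ ranging over representatives of the $\mathrm{SL}_2(\mathbb{Z})$-orbits of index $N$ sublattices. In particular $T_1=\mathrm{id}$. For a prime $p$, $\mathbf{e}_p:=\pi_*\pi^*-\mathrm{id}$ on $\mathbb{Z}\lambda(\mathrm{SL}_2(\mathbb{Z}))$, where $\pi:\Gamma_0(p)\hookrightarrow\mathrm{SL}_2(\mathbb{Z})$ is the inclusion of the subgroup of matrices that are upper triangular mod $p$. *)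

theory Defs
  imports
    "HOL-Analysis.Determinants"
    "HOL-Algebra.Group_Action"
    "HOL-Algebra.Generated_Groups"
    "HOL-Algebra.Free_Abelian_Groups"
    "HOL-Computational_Algebra.Primes"
begin

section \<open>Conjugacy classes, pushforward and pullback\<close>

definition conj_act :: "('a, 'm) monoid_scheme \<Rightarrow> 'a \<Rightarrow> 'a \<Rightarrow> 'a" where
  "conj_act G g x = g \<otimes>\<^bsub>G\<^esub> x \<otimes>\<^bsub>G\<^esub> inv\<^bsub>G\<^esub> g"

definition conj_class :: "('a, 'm) monoid_scheme \<Rightarrow> 'a \<Rightarrow> 'a set" where
  "conj_class G x = orbit G (conj_act G) x"

definition conj_classes :: "('a, 'm) monoid_scheme \<Rightarrow> 'a set set" where
  "conj_classes G = orbits G (carrier G) (conj_act G)"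

text \<open>
  The free abelian group on the conjugacy classes of \<open>G\<close> is
  \<open>free_Abelian_group (conj_classes G)\<close>.  The maps below are linear extensions of maps
  on basis elements.  Wherever \<open>SOME\<close> selects a representative (of a conjugacy
  class, a double coset, an orbit, or a basis matrix of a lattice), the result does not
  depend on the selection.
\<close>

definition push :: "('b, 'n) monoid_scheme \<Rightarrow> ('a \<Rightarrow> 'b) \<Rightarrow> ('a set \<Rightarrow>\<^sub>0 int) \<Rightarrow> ('b set \<Rightarrow>\<^sub>0 int)" where
  "push G' \<psi> = frag_extend (\<lambda>c. frag_of (conj_class G' (\<psi> (SOME x. x \<in> c))))"

definition double_cosets :: "('a, 'm) monoid_scheme \<Rightarrow> 'a set \<Rightarrow> 'a set \<Rightarrow> 'a set set" where
  "double_cosets G H K = (\<lambda>g. (H #>\<^bsub>G\<^esub> g) <#>\<^bsub>G\<^esub> K) ` carrier G"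

definition return_time :: "('a, 'm) monoid_scheme \<Rightarrow> 'a set \<Rightarrow> 'a \<Rightarrow> 'a \<Rightarrow> nat" where
  "return_time G H a g = (LEAST k. k > 0 \<and> conj_act G g (a [^]\<^bsub>G\<^esub> k) \<in> H)"

definition pull_class :: "('a, 'm) monoid_scheme \<Rightarrow> 'a set \<Rightarrow> 'a \<Rightarrow> ('a set \<Rightarrow>\<^sub>0 int)" where
  "pull_class G H a =
     (\<Sum>s \<in> double_cosets G H (generate G {a}).
        let g = (SOME g. g \<in> s)
        in frag_of (conj_class (G\<lparr>carrier := H\<rparr>)
             (conj_act G g (a [^]\<^bsub>G\<^esub> return_time G H a g))))"

definition pull :: "('a, 'm) monoid_scheme \<Rightarrow> 'a set \<Rightarrow> ('a set \<Rightarrow>\<^sub>0 int) \<Rightarrow> ('a set \<Rightarrow>\<^sub>0 int)" where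
  "pull G H = frag_extend (\<lambda>c. pull_class G H (SOME x. x \<in> c))"


section \<open>The modular group and the Hecke operators\<close>

definition SL2Z :: "(int^2^2) monoid" where
  "SL2Z = \<lparr>carrier = {A. det A = 1}, mult = (**), one = mat 1\<rparr>"

lemma group_SL2Z: "group SL2Z"
proof (rule groupI)
  fix A assume A: "A \<in> carrier SL2Z"
  define B :: "int^2^2" where
    "B = (\<chi> i j. if i = 1 then (if j = 1 then A$2$2 else - A$1$2)
                  else (if j = 1 then - A$2$1 else A$1$1))"
  have "A$1$1 * A$2$2 - A$1$2 * A$2$1 = 1"
    using A by (simp add: SL2Z_def det_2)
  then have "det B = 1" "B ** A = mat 1"
    by (simp_all add: B_def det_2 vec_eq_iff forall_2 matrix_matrix_mult_def sum_2 mat_def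
        algebra_simps)
  then show "\<exists>B\<in>carrier SL2Z. B \<otimes>\<^bsub>SL2Z\<^esub> A = \<one>\<^bsub>SL2Z\<^esub>"
    by (auto simp: SL2Z_def)
qed (auto simp: SL2Z_def det_mul matrix_mul_assoc)

definition Z2 :: "(int^2) monoid" where
  "Z2 = \<lparr>carrier = UNIV, mult = (+), one = 0\<rparr>"

text \<open>For \<open>N = 0\<close> these would be the subgroups of infinite index; only \<open>N > 0\<close> is used.\<close>

definition sublattices :: "nat \<Rightarrow> (int^2) set set" where
  "sublattices N = {L. subgroup L Z2 \<and> card (rcosets\<^bsub>Z2\<^esub> L) = N}"

definition lattice_act :: "int^2^2 \<Rightarrow> (int^2) set \<Rightarrow> (int^2) set" where
  "lattice_act \<gamma> L = (\<lambda>v. v v* \<gamma>) ` L"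

definition basis_matrix :: "nat \<Rightarrow> (int^2) set \<Rightarrow> int^2^2" where
  "basis_matrix N L = (SOME A. det A = int N \<and> L = range (\<lambda>v. v v* A))"

text \<open>
  The inverse of a basis matrix has rational entries; \<open>lattice_hom N L \<gamma>\<close> is the integral
  matrix \<open>A \<gamma> A\<inverse>\<close>, which exists for \<open>\<gamma>\<close> in the stabilizer of \<open>L\<close>.
\<close>

definition lattice_hom :: "nat \<Rightarrow> (int^2) set \<Rightarrow> int^2^2 \<Rightarrow> int^2^2" where
  "lattice_hom N L \<gamma> =
     (let A = map_matrix rat_of_int (basis_matrix N L)
      in THE B. map_matrix rat_of_int B = A ** map_matrix rat_of_int \<gamma> ** matrix_inv A)"

definition hecke :: "nat \<Rightarrow> ((int^2^2) set \<Rightarrow>\<^sub>0 int) \<Rightarrow> ((int^2^2) set \<Rightarrow>\<^sub>0 int)" where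
  "hecke N x =
     (\<Sum>S \<in> orbits SL2Z (sublattices N) lattice_act.
        let L = (SOME L. L \<in> S)
        in push SL2Z (lattice_hom N L) (pull SL2Z (stabilizer SL2Z lattice_act L) x))"

definition Gamma0 :: "nat \<Rightarrow> (int^2^2) set" where
  "Gamma0 N = {\<gamma> \<in> carrier SL2Z. int N dvd \<gamma> $ 2 $ 1}"

definition e_op :: "nat \<Rightarrow> ((int^2^2) set \<Rightarrow>\<^sub>0 int) \<Rightarrow> ((int^2^2) set \<Rightarrow>\<^sub>0 int)" where
  "e_op p x = push SL2Z id (pull SL2Z (Gamma0 p) x) - x"

end

theory Submission
  imports Defs
begin

text \<open>
  Pair everything with an arbitrary additive map into the rationals.
  A double coset \<open>\<Gamma>\<^sub>L g \<langle>a\<rangle>\<close> is an \<open>a\<close>-orbit in the \<open>SL\<^sub>2(\<int>)\<close>-orbit of \<open>L\<close>, so \<open>T\<^sub>N [a]\<close> becomes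
  the sum over all sublattices \<open>M\<close> of index \<open>N\<close> of \<open>[A\<^sub>M a\<^sup>d A\<^sub>M\<^sup>-\<^sup>1] / d\<close>, where \<open>d\<close> is the period of \<open>M\<close> under
  \<open>a\<close>. Composites of operators are then sums over flags, weighted by the joint period.
  In \<open>T\<^bsub>p^n\<^esub> T\<^sub>p\<close> the flags are \<open>L \<subseteq> M \<subseteq> \<int>\<^sup>2\<close> with \<open>M\<close> of index \<open>p\<close> and \<open>L\<close> of index \<open>p^(n+1)\<close>. If \<open>L\<close> is not contained
  in \<open>p \<int>\<^sup>2\<close>, then \<open>M\<close> is determined by \<open>L\<close> and the joint period is that of \<open>L\<close>. Otherwise \<open>L = p K\<close> and all \<open>p + 1\<close>
  choices of \<open>M\<close> occur, which yields \<open>T\<^bsub>p^(n-1)\<^esub> \<pi>\<^sub>* \<pi>\<^sup>*\<close>, whereas \<open>T\<^bsub>p^(n+1)\<^esub>\<close> counts each such \<open>L\<close> once, which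
  accounts for the identity subtracted in \<open>e\<^sub>p\<close>.
\<close>

section \<open>Periods and double cosets\<close>

text \<open>The analogue of \<open>return_time\<close> for a point of an action. The value is
  meaningful when some positive power of \<open>a\<close> fixes \<open>x\<close>, which a finite
  orbit guarantees.\<close>

definition period :: "('a, 'm) monoid_scheme \<Rightarrow> ('a \<Rightarrow> 'x \<Rightarrow> 'x) \<Rightarrow> 'a \<Rightarrow> 'x \<Rightarrow> nat" where
  "period G act a x = (LEAST k. k > 0 \<and> act (a [^]\<^bsub>G\<^esub> k) x = x)"

text \<open>The order in \<open>act_mult\<close> is that of a right action, matching row vectors
  multiplied by matrices on the right.\<close>

locale right_action = group G for G (structure) +
  fixes act :: "'a \<Rightarrow> 'x \<Rightarrow> 'x"
  assumes act_one: "act \<one> x = x"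
    and act_mult: "\<lbrakk>g \<in> carrier G; h \<in> carrier G\<rbrakk> \<Longrightarrow> act (g \<otimes> h) x = act h (act g x)"
begin

lemma act_inv_iff:
  assumes "g \<in> carrier G"
  shows "act (inv g) x = y \<longleftrightarrow> x = act g y"
  using assms act_mult[of g "inv g" y] act_mult[of "inv g" g x] act_one
  by (metis inv_closed l_inv r_inv)

lemma inj_act: "g \<in> carrier G \<Longrightarrow> inj (act g)"
  by (metis act_inv_iff injI)

lemma act_pow_add:
  assumes "a \<in> carrier G"
  shows "act (a [^] (j + k :: nat)) x = act (a [^] k) (act (a [^] j) x)"
  using assms by (simp add: act_mult flip: nat_pow_mult)

lemma act_pow_mult_fix:
  assumes "a \<in> carrier G" "act (a [^] (d::nat)) x = x"
  shows "act (a [^] (d * q)) x = x"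
proof (induction q)
  case (Suc q)
  then show ?case
    using act_pow_add[OF assms(1), of d "d * q" x] assms(2) by simp
qed (simp add: act_one)

text \<open>Pigeonhole: two powers of \<open>a\<close> send \<open>x\<close> to the same point of
  its finite orbit, and injectivity of the action cancels the smaller power.\<close>

lemma finite_orbit_periodic:
  assumes a: "a \<in> carrier G" and "finite (orbit G act x)"
  shows "\<exists>k::nat. k > 0 \<and> act (a [^] k) x = x"
proof -
  let ?f = "\<lambda>k::nat. act (a [^] k) x"
  have "range ?f \<subseteq> orbit G act x"
    using a by (auto simp: orbit_def)
  then have "\<not> inj ?f"
    using assms(2) by (meson finite_subset range_inj_infinite)
  then obtain i j where "i < j" "?f i = ?f j"
    unfolding inj_def by (metis linorder_neqE_nat)
  moreover have "?f j = act (a [^] i) (?f (j - i))"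
    using act_pow_add[OF a, of "j - i" i x] \<open>i < j\<close> by simp
  ultimately have "?f (j - i) = x"
    using inj_act[of "a [^] i"] a by (metis injD nat_pow_closed)
  then show ?thesis
    using \<open>i < j\<close> by (intro exI[of _ "j - i"]) simp
qed

context
  fixes a x
  assumes a: "a \<in> carrier G" and fin: "finite (orbit G act x)"
begin

lemma period_pos: "period G act a x > 0"
  and act_period: "act (a [^] period G act a x) x = x"
  using LeastI_ex[OF finite_orbit_periodic[OF a fin]] unfolding period_def by blast+

text \<open>Removing full periods from \<open>k\<close> leaves a power below the period that still
  fixes \<open>x\<close>, so minimality forces the remainder to be 0.\<close>

lemma fix_iff_period_dvd: "act (a [^] k) x = x \<longleftrightarrow> period G act a x dvd k"
proof
  let ?d = "period G act a x"
  assume "act (a [^] k) x = x"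
  moreover have "act (a [^] k) x = act (a [^] (k mod ?d)) (act (a [^] (?d * (k div ?d))) x)"
    by (metis a act_pow_add mult_div_mod_eq)
  ultimately have "act (a [^] (k mod ?d)) x = x"
    using act_pow_mult_fix[OF a act_period] by simp
  then have "k mod ?d = 0"
    using not_less_Least[of "k mod ?d" "\<lambda>k. k > 0 \<and> act (a [^] k) x = x"] period_pos
    by (fold period_def) auto
  then show "?d dvd k" by auto
next
  assume "period G act a x dvd k"
  then show "act (a [^] k) x = x"
    using act_pow_mult_fix[OF a act_period] by (auto elim!: dvdE)
qed

lemma period_eqI:
  assumes "\<And>k::nat. act (a [^] k) x = x \<longleftrightarrow> d dvd k"
  shows "period G act a x = d"
  using assms fix_iff_period_dvd by (metis dvd_antisym dvd_refl)

end

lemma orbit_act_iff: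
  assumes "g \<in> carrier G"
  shows "act g x \<in> orbit G act y \<longleftrightarrow> x \<in> orbit G act y"
proof
  assume "act g x \<in> orbit G act y"
  then obtain h where "h \<in> carrier G" "act g x = act h y"
    by (auto simp: orbit_def)
  then have "x = act (h \<otimes> inv g) y"
    using assms act_inv_iff by (metis act_mult inv_closed)
  then show "x \<in> orbit G act y"
    using assms \<open>h \<in> carrier G\<close> by (auto simp: orbit_def)
next
  assume "x \<in> orbit G act y"
  then obtain h where "h \<in> carrier G" "x = act h y"
    by (auto simp: orbit_def)
  then show "act g x \<in> orbit G act y"
    using assms by (auto simp: orbit_def act_mult intro!: exI[of _ "h \<otimes> g"])
qed

lemma orbit_refl: "x \<in> orbit G act x"
  by (auto simp: orbit_def act_one intro!: exI[of _ \<one>])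

lemma orbit_eq:
  assumes "y \<in> orbit G act x"
  shows "orbit G act y = orbit G act x"
proof -
  obtain g where g: "g \<in> carrier G" "y = act g x"
    using assms by (auto simp: orbit_def)
  have "z \<in> orbit G act y \<longleftrightarrow> z \<in> orbit G act x" for z
  proof
    assume "z \<in> orbit G act y"
    then show "z \<in> orbit G act x"
      using assms orbit_act_iff by (auto simp: orbit_def[of G act y])
  next
    assume "z \<in> orbit G act x"
    moreover have "x \<in> orbit G act y"
      using g orbit_act_iff orbit_refl by blast
    ultimately show "z \<in> orbit G act y"
      using orbit_act_iff by (auto simp: orbit_def[of G act x])
  qed
  then show ?thesis by blast
qed

text \<open>Nonnegative powers suffice: when the orbit of \<open>x\<close> is finite, this is the
  whole orbit under the cyclic group generated by \<open>a\<close>, by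
  \<open>int_pow_in_cyc\<close>.\<close>

definition cyc :: "'a \<Rightarrow> 'x \<Rightarrow> 'x set" where
  "cyc a x = range (\<lambda>k::nat. act (a [^] k) x)"

text \<open>Weights 1/period therefore add up to 1 along each cycle, which is what turns a sum over
  double cosets into a sum over points.\<close>

lemma card_cyc:
  assumes a: "a \<in> carrier G" and fin: "finite (orbit G act x)"
  shows "card (cyc a x) = period G act a x"
proof -
  let ?d = "period G act a x" and ?f = "\<lambda>k::nat. act (a [^] k) x"
  have "?f k = ?f (k mod ?d)" for k
  proof -
    have "?f k = act (a [^] (k mod ?d)) (act (a [^] (?d * (k div ?d))) x)"
      by (metis a act_pow_add mult_div_mod_eq)
    then show ?thesis
      using act_pow_mult_fix[OF a act_period[OF a fin]] by simp
  qed
  then have "cyc a x = ?f ` {..<?d}"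
    unfolding cyc_def using period_pos[OF a fin]
    by (auto simp: image_iff) (metis lessThan_iff mod_less_divisor)
  moreover have "inj_on ?f {..<?d}"
  proof -
    have "False" if "i < j" "j < ?d" "?f i = ?f j" for i j
    proof -
      have "?f j = act (a [^] i) (?f (j - i))"
        using act_pow_add[OF a, of "j - i" i x] \<open>i < j\<close> by simp
      then have "?f (j - i) = x"
        using inj_act[of "a [^] i"] a that(3) by (metis injD nat_pow_closed)
      then have "?d dvd j - i"
        using fix_iff_period_dvd[OF a fin] by simp
      then show False
        using that(1,2) by (meson dvd_imp_le less_imp_diff_less not_le zero_less_diff)
    qed
    then show ?thesis
      unfolding inj_on_def by (metis lessThan_iff linorder_neqE_nat)
  qed
  ultimately show ?thesis
    by (simp add: card_image)
qed

lemma cyc_eq: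
  assumes a: "a \<in> carrier G" and fin: "finite (orbit G act x)" and y: "y \<in> cyc a x"
  shows "cyc a y = cyc a x"
proof -
  let ?d = "period G act a x"
  obtain j :: nat where j: "y = act (a [^] j) x"
    using y by (auto simp: cyc_def)
  \<comment> \<open>The way back from \<open>y\<close> to \<open>x\<close> by a natural power:
    \<open>j\<close> steps followed by \<open>?d * j - j\<close> make a multiple of the period.
    Positivity of the period keeps the subtraction from truncating.\<close>
  have "x = act (a [^] (?d * j - j)) y"
    using act_pow_add[OF a, of j "?d * j - j" x] act_pow_mult_fix[OF a act_period[OF a fin], of j]
      period_pos[OF a fin] by (simp add: j)
  then have "act (a [^] k) x = act (a [^] ((?d * j - j) + k)) y" for k :: nat
    using act_pow_add[OF a] by metis
  moreover have "act (a [^] k) y = act (a [^] (j + k)) x" for k :: nat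
    using act_pow_add[OF a] j by metis
  ultimately show ?thesis
    unfolding cyc_def by (auto simp: image_iff)
qed

lemma int_pow_in_cyc:
  assumes a: "a \<in> carrier G" and fin: "finite (orbit G act x)"
  shows "act (a [^] (k::int)) x \<in> cyc a x"
proof (cases k)
  case (nonneg n)
  then have "act (a [^] k) x = act (a [^] n) x"
    by (simp add: int_pow_int)
  then show ?thesis
    by (simp add: cyc_def)
next
  case (neg n)
  define m where "m = Suc n"
  have "a [^] k = inv (a [^] m)"
    using a int_pow_neg_int[of a m] neg by (simp only: m_def)
  then have "x = act (a [^] m) (act (a [^] k) x)"
    using a act_inv_iff by (metis nat_pow_closed)
  then have x: "x \<in> cyc a (act (a [^] k) x)"
    unfolding cyc_def by blast
  have "orbit G act (act (a [^] k) x) = orbit G act x"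
    using a by (intro orbit_eq) (auto simp: orbit_def)
  then have "cyc a x = cyc a (act (a [^] k) x)"
    using cyc_eq[OF a _ x] fin by simp
  moreover have "act (a [^] k) x \<in> cyc a (act (a [^] k) x)"
    by (auto simp: cyc_def act_one intro!: image_eqI[of _ _ 0])
  ultimately show ?thesis by simp
qed

lemma stabilizer_subgroup: "subgroup (stabilizer G act x) G"
proof (rule subgroupI)
  show "stabilizer G act x \<noteq> {}"
    by (auto simp: stabilizer_def act_one intro: exI[of _ \<one>])
qed (auto simp: stabilizer_def act_mult act_inv_iff)

text \<open>Sending \<open>g\<close> to \<open>act g x\<close> identifies right cosets of the
  stabilizer with points of the orbit; right multiplication by powers of \<open>a\<close> then moves
  a point along its cycle.\<close>

lemma double_coset_stabilizer:
  assumes a: "a \<in> carrier G" and g: "g \<in> carrier G" and fin: "finite (orbit G act x)"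
  shows "(stabilizer G act x #> g) <#> generate G {a} = {g' \<in> carrier G. act g' x \<in> cyc a (act g x)}"
proof -
  have fin': "finite (orbit G act (act g x))"
    using orbit_eq[of "act g x" x] g fin orbit_act_iff orbit_refl by simp
  have "(stabilizer G act x #> g) <#> generate G {a}
      = {h \<otimes> g \<otimes> a [^] k | h k. h \<in> stabilizer G act x \<and> k \<in> (UNIV::int set)}"
    using generate_pow[OF a] by (auto simp: r_coset_def set_mult_def)
  also have "\<dots> = {g' \<in> carrier G. act g' x \<in> cyc a (act g x)}"
  proof (intro equalityI subsetI)
    fix g' assume "g' \<in> {h \<otimes> g \<otimes> a [^] k | h k. h \<in> stabilizer G act x \<and> k \<in> (UNIV::int set)}"
    then show "g' \<in> {g' \<in> carrier G. act g' x \<in> cyc a (act g x)}"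
      using a g int_pow_in_cyc[OF a fin'] by (auto simp: stabilizer_def act_mult)
  next
    fix g' assume "g' \<in> {g' \<in> carrier G. act g' x \<in> cyc a (act g x)}"
    then obtain k :: nat where g': "g' \<in> carrier G" "act g' x = act (a [^] k) (act g x)"
      by (auto simp: cyc_def)
    \<comment> \<open>Both \<open>g'\<close> and \<open>g \<otimes> a [^] k\<close> carry
      \<open>x\<close> to the same point, so this quotient fixes \<open>x\<close>.\<close>
    let ?h = "g' \<otimes> inv (g \<otimes> a [^] k)"
    have "act ?h x = x"
      using a g g' by (simp add: act_mult act_inv_iff del: inv_mult_group)
    moreover have "?h \<in> carrier G"
      using a g g' by simp
    moreover have "g' = ?h \<otimes> g \<otimes> a [^] (int k)"
      using a g g' by (simp add: int_pow_int m_assoc flip: inv_mult_group)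
    ultimately show "g' \<in> {h \<otimes> g \<otimes> a [^] k | h k. h \<in> stabilizer G act x \<and> k \<in> (UNIV::int set)}"
      by (auto simp: stabilizer_def)
  qed
  finally show ?thesis .
qed

lemma conj_act_pow:
  assumes "a \<in> carrier G" "g \<in> carrier G"
  shows "conj_act G g a [^] (k::nat) = conj_act G g (a [^] k)"
proof (induction k)
  case (Suc k)
  have "inv g \<otimes> (g \<otimes> (a \<otimes> inv g)) = a \<otimes> inv g"
    using assms by (simp flip: m_assoc)
  with Suc show ?case
    using assms by (simp add: conj_act_def m_assoc)
qed (use assms in \<open>simp add: conj_act_def\<close>)

lemma act_conj_act_fix_iff:
  assumes "a \<in> carrier G" "g \<in> carrier G"
  shows "act (conj_act G g a) x = x \<longleftrightarrow> act a (act g x) = act g x"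
  using assms act_inv_iff[OF assms(2)] by (simp add: conj_act_def act_mult)

lemma return_time_stabilizer:
  assumes "a \<in> carrier G" "g \<in> carrier G"
  shows "return_time G (stabilizer G act x) a g = period G act a (act g x)"
proof -
  have "conj_act G g (a [^] k) \<in> carrier G" for k :: nat
    using assms by (simp add: conj_act_def)
  then show ?thesis
    unfolding return_time_def period_def stabilizer_def
    using assms by (simp add: act_conj_act_fix_iff)
qed

lemma period_conj_act:
  assumes "a \<in> carrier G" "g \<in> carrier G"
  shows "period G act (conj_act G g a) x = period G act a (act g x)"
  unfolding period_def using assms by (simp add: conj_act_pow act_conj_act_fix_iff)

text \<open>A double coset is a cycle of \<open>a\<close> in the orbit. Its single summand is spread
  evenly over the \<open>d\<close> points of the cycle with weight 1/d, which removes the choice of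
  representatives; this is why \<open>h\<close> takes rational values.\<close>

lemma pull_class_sum:
  fixes h :: "('a set \<Rightarrow>\<^sub>0 int) \<Rightarrow> rat" and \<phi> :: "'x \<Rightarrow> rat"
  assumes a: "a \<in> carrier G" and fin: "finite (orbit G act x)"
    and h: "additive h"
    and \<phi>: "\<And>g. g \<in> carrier G \<Longrightarrow>
      h (frag_of (conj_class (G\<lparr>carrier := stabilizer G act x\<rparr>)
           (conj_act G g (a [^] period G act a (act g x))))) = \<phi> (act g x)"
  shows "h (pull_class G (stabilizer G act x) a)
    = (\<Sum>y \<in> orbit G act x. \<phi> y / of_nat (period G act a y))"
proof -
  let ?O = "orbit G act x" and ?H = "stabilizer G act x"
  let ?per = "period G act a"
  \<comment> \<open>The double coset that belongs to the cycle of \<open>y\<close>; by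
    \<open>D_iff\<close>, distinct cycles give distinct double cosets.\<close>
  define D where "D y = {g \<in> carrier G. act g x \<in> cyc a y}" for y
  have finO: "finite (orbit G act y)" if "y \<in> ?O" for y
    using orbit_eq[OF that] fin by simp
  have cyc_refl: "y \<in> cyc a y" for y
    by (auto simp: cyc_def act_one intro!: image_eqI[of _ _ 0])
  have cycO: "cyc a y \<subseteq> ?O" if "y \<in> ?O" for y
    using orbit_act_iff a that by (auto simp: cyc_def)
  have D_iff: "D y = D z \<longleftrightarrow> cyc a y = cyc a z" if yz: "y \<in> ?O" "z \<in> ?O" for y z
  proof
    assume "D y = D z"
    obtain g where g: "g \<in> carrier G" "act g x = y"
      using yz by (auto simp: orbit_def)
    then have "g \<in> D z"
      using \<open>D y = D z\<close> cyc_refl by (auto simp: D_def)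
    then show "cyc a y = cyc a z"
      using g cyc_eq[OF a finO[OF yz(2)]] by (auto simp: D_def)
  qed (simp add: D_def)
  have "double_cosets G ?H (generate G {a}) = (\<lambda>g. D (act g x)) ` carrier G"
    unfolding double_cosets_def using double_coset_stabilizer[OF a _ fin] by (auto simp: D_def)
  also have "\<dots> = D ` ?O"
    by (auto simp: orbit_def)
  finally have dc: "double_cosets G ?H (generate G {a}) = D ` ?O" .
  have summand: "h (let g = (SOME g. g \<in> s) in frag_of (conj_class (G\<lparr>carrier := ?H\<rparr>)
             (conj_act G g (a [^] return_time G ?H a g))))
      = (\<Sum>y \<in> {y \<in> ?O. D y = s}. \<phi> y / of_nat (?per y))" (is "?l = ?r") if s: "s \<in> D ` ?O" for s
  proof -
    define g where "g = (SOME g. g \<in> s)"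
    obtain y where y: "y \<in> ?O" "s = D y"
      using s by blast
    obtain g' where "g' \<in> carrier G" "act g' x = y"
      using y by (auto simp: orbit_def)
    then have "g' \<in> s"
      using y cyc_refl by (auto simp: D_def)
    then have "g \<in> s"
      unfolding g_def by (rule someI)
    then have g: "g \<in> carrier G" "act g x \<in> cyc a y"
      using y by (auto simp: D_def)
    let ?z = "act g x"
    have z: "?z \<in> ?O"
      using g by (auto simp: orbit_def)
    have "s = D ?z"
      using D_iff[OF y(1) z] y(2) cyc_eq[OF a finO[OF y(1)] g(2)] by metis
    then have "{y \<in> ?O. D y = s} = {y \<in> ?O. cyc a y = cyc a ?z}"
      using D_iff[OF _ z] by blast
    also have "\<dots> = cyc a ?z"
      using cyc_refl cycO[OF z] cyc_eq[OF a finO[OF z]] by blast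
    finally have fiber: "{y \<in> ?O. D y = s} = cyc a ?z" .
    \<comment> \<open>Another point of the cycle is reached by \<open>g \<otimes> a [^] k\<close>.
      It has the same period, and conjugation gives the same element because powers of
      \<open>a\<close> commute, so the summand is constant on the cycle.\<close>
    have const: "\<phi> w = \<phi> ?z" "?per w = ?per ?z" if "w \<in> cyc a ?z" for w
    proof -
      obtain k :: nat where w: "w = act (a [^] k) ?z"
        using \<open>w \<in> cyc a ?z\<close> by (auto simp: cyc_def)
      have "cyc a w = cyc a ?z" "w \<in> ?O"
        using that cyc_eq[OF a finO[OF z]] cycO[OF z] by blast+
      then show per: "?per w = ?per ?z"
        using card_cyc[OF a] finO z by metis
      have gk: "g \<otimes> a [^] k \<in> carrier G" "w = act (g \<otimes> a [^] k) x"
        using a g w by (auto simp: act_mult)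
      have "conj_act G (g \<otimes> a [^] k) (a [^] d) = conj_act G g (a [^] d)" for d :: nat
      proof -
        have "a [^] k \<otimes> a [^] d \<otimes> inv (a [^] k) = a [^] d \<otimes> (a [^] k \<otimes> inv (a [^] k))"
          using a by (metis inv_closed m_assoc nat_pow_closed nat_pow_comm)
        then have "a [^] k \<otimes> a [^] d \<otimes> inv (a [^] k) = a [^] d"
          using a by simp
        then show ?thesis
          using a g by (simp add: conj_act_def inv_mult_group) (simp flip: m_assoc, simp add: m_assoc)
      qed
      then show "\<phi> w = \<phi> ?z"
        using \<phi>[OF gk(1)] \<phi>[OF g(1)] per gk(2) by simp
    qed
    have "?r = (\<Sum>y \<in> cyc a ?z. \<phi> ?z / of_nat (?per ?z))"
      using const fiber by simp
    also have "\<dots> = \<phi> ?z"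
      using card_cyc[OF a finO[OF z]] period_pos[OF a finO[OF z]] by simp
    also have "\<dots> = ?l"
      using \<phi>[OF g(1)] return_time_stabilizer[OF a g(1)] by (simp add: Let_def flip: g_def)
    finally show ?thesis by simp
  qed
  have "h (pull_class G ?H a) = (\<Sum>s \<in> D ` ?O. \<Sum>y \<in> {y \<in> ?O. D y = s}. \<phi> y / of_nat (?per y))"
    unfolding pull_class_def dc additive.sum[OF h] using summand by (intro sum.cong) auto
  then show ?thesis
    using sum.image_gen[OF fin, of "\<lambda>y. \<phi> y / of_nat (?per y)" D] by simp
qed

end

section \<open>Integral 2 by 2 matrices and the lattices spanned by their rows\<close>

abbreviation mat2 :: "int \<Rightarrow> int \<Rightarrow> int \<Rightarrow> int \<Rightarrow> int^2^2" where
  "mat2 a b c d \<equiv> vector [vector [a, b], vector [c, d]]"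

abbreviation vec2 :: "int \<Rightarrow> int \<Rightarrow> int^2" where
  "vec2 a b \<equiv> vector [a, b]"

lemmas coords_2 = vec_eq_iff forall_2 matrix_matrix_mult_def vector_matrix_mult_def sum_2 mat_def det_2

definition lat :: "int^2^2 \<Rightarrow> (int^2) set" where
  "lat A = range (\<lambda>v. v v* A)"

text \<open>The adjugate, an integral substitute for the inverse: it inverts a matrix up to the
  factor \<open>det A\<close>.\<close>

definition adj2 :: "int^2^2 \<Rightarrow> int^2^2" where
  "adj2 A = mat2 (A$2$2) (- A$1$2) (- A$2$1) (A$1$1)"

lemma mult_adj2: "A ** adj2 A = mat (det A)" "adj2 A ** A = mat (det A)"
  by (simp_all add: coords_2 adj2_def algebra_simps)

lemma mult_right_cancel_2:
  fixes A B C :: "int^2^2"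
  assumes "det A \<noteq> 0" "B ** A = C ** A"
  shows "B = C"
proof -
  have "B ** mat (det A) = C ** mat (det A)"
    using assms(2) by (metis matrix_mul_assoc mult_adj2(1))
  then show ?thesis
    using assms(1) by (simp add: coords_2)
qed

lemma lattice_act_lat: "lattice_act B (lat A) = lat (A ** B)"
  unfolding lattice_act_def lat_def image_image by (simp add: vector_matrix_mul_assoc)

lemma lat_mat_1: "lat (mat 1) = UNIV"
  by (auto simp: lat_def)

text \<open>The rows of \<open>C\<close> are the coordinates of the rows of \<open>A\<close> with
  respect to the rows of \<open>B\<close>.\<close>

lemma lat_subset_iff: "lat A \<subseteq> lat B \<longleftrightarrow> (\<exists>C. A = C ** B)"
proof
  assume sub: "lat A \<subseteq> lat B"
  have "v v* A \<in> range (\<lambda>w. w v* B)" for v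
    using sub unfolding lat_def by blast
  then obtain r s where "vec2 1 0 v* A = r v* B" "vec2 0 1 v* A = s v* B"
    by blast
  moreover have "vec2 1 0 v* A = A $ 1" "vec2 0 1 v* A = A $ 2"
    by (simp_all add: coords_2)
  ultimately have rs: "A $ 1 = r v* B" "A $ 2 = s v* B"
    by simp_all
  have "A = vector [r, s] ** B"
    using rs by (simp add: coords_2)
  then show "\<exists>C. A = C ** B" ..
next
  assume "\<exists>C. A = C ** B"
  then obtain C where C: "A = C ** B" ..
  show "lat A \<subseteq> lat B"
    unfolding lat_def C vector_matrix_mul_assoc[symmetric] by blast
qed

lemma lat_mult_SL2:
  assumes "det C = 1"
  shows "lat (C ** B) = lat B"
proof
  have "B = adj2 C ** (C ** B)"
    using assms by (simp add: matrix_mul_assoc mult_adj2)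
  then show "lat B \<subseteq> lat (C ** B)"
    by (metis lat_subset_iff)
  show "lat (C ** B) \<subseteq> lat B"
    unfolding lat_subset_iff by blast
qed

text \<open>The two transition matrices are inverse to each other, so their determinants are units;
  equal orientation of the bases excludes -1.\<close>

lemma lat_eqE:
  assumes "lat A = lat B" "det A > 0" "det B > 0"
  obtains C where "det C = 1" "A = C ** B"
proof -
  obtain C D where C: "A = C ** B" and D: "B = D ** A"
    using assms(1) by (metis lat_subset_iff order_refl)
  then have "mat 1 ** A = (C ** D) ** A"
    by (metis matrix_mul_assoc matrix_mul_lid)
  then have "C ** D = mat 1"
    using mult_right_cancel_2[of A] assms(2) by force
  then have "det C * det D = 1"
    by (metis det_I det_mul)
  moreover have "det C > 0"
    using C assms(2,3) by (simp add: det_mul zero_less_mult_iff)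
  ultimately have "det C = 1"
    using zmult_eq_1_iff by force
  with C show thesis by (rule that[rotated])
qed

lemma lat_subset_det_eq:
  assumes "lat A \<subseteq> lat B" "det A = det B" "det B \<noteq> 0"
  shows "lat A = lat B"
proof -
  obtain C where C: "A = C ** B"
    using assms(1) lat_subset_iff by blast
  then have "det C = 1"
    using assms(2,3) by (simp add: det_mul)
  then show ?thesis
    using C lat_mult_SL2 by simp
qed

lemma det_scaled_in_lat: "det A *s v \<in> lat A"
proof -
  have "det A *s v = v v* mat (det A)"
    by (simp add: coords_2)
  also have "\<dots> = (v v* adj2 A) v* A"
    by (simp add: vector_matrix_mul_assoc mult_adj2)
  finally show ?thesis
    by (simp add: lat_def)
qed

section \<open>Sublattices of the integer plane\<close>

lemma Z2_simps [simp]: "carrier Z2 = UNIV" "x \<otimes>\<^bsub>Z2\<^esub> y = x + y" "\<one>\<^bsub>Z2\<^esub> = 0"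
  by (simp_all add: Z2_def)

lemma group_Z2: "group Z2"
proof (rule groupI)
  fix x assume "x \<in> carrier Z2"
  show "\<exists>y\<in>carrier Z2. y \<otimes>\<^bsub>Z2\<^esub> x = \<one>\<^bsub>Z2\<^esub>"
    by (intro bexI[of _ "- x"]) simp_all
qed (simp_all add: add.assoc)

lemma inv_Z2: "inv\<^bsub>Z2\<^esub> x = - x"
  using group.inv_equality[OF group_Z2, of "- x" x] by simp

lemma subgroup_Z2_iff:
  "subgroup L Z2 \<longleftrightarrow> 0 \<in> L \<and> (\<forall>x\<in>L. \<forall>y\<in>L. x - y \<in> L)" (is "?l = ?r")
proof
  assume ?l
  then show ?r
    using subgroup.m_closed[of L Z2] subgroup.m_inv_closed[of L Z2] subgroup.one_closed[of L Z2]
    by (auto simp: inv_Z2) (metis add_uminus_conv_diff)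
next
  assume r: ?r
  then have neg: "- x \<in> L" if "x \<in> L" for x
    using that by (metis diff_0)
  have "x + y \<in> L" if "x \<in> L" "y \<in> L" for x y
    using r that neg by (metis diff_minus_eq_add)
  with r neg show ?l
    by (intro group.subgroupI[OF group_Z2]) (auto simp: inv_Z2)
qed

lemma subgroup_Z2_closed:
  assumes "subgroup L Z2"
  shows "0 \<in> L" "x \<in> L \<Longrightarrow> y \<in> L \<Longrightarrow> x - y \<in> L" "x \<in> L \<Longrightarrow> y \<in> L \<Longrightarrow> x + y \<in> L"
    "x \<in> L \<Longrightarrow> k *s x \<in> L"
proof -
  show 0: "0 \<in> L"
    using assms by (auto simp: subgroup_Z2_iff)
  show diff: "x - y \<in> L" if "x \<in> L" "y \<in> L" for x y
    using assms that by (auto simp: subgroup_Z2_iff)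
  show add: "x + y \<in> L" if "x \<in> L" "y \<in> L" for x y
    using subgroup.m_closed[OF assms that] by simp
  show "k *s x \<in> L" if "x \<in> L" for k x
  proof (induction k rule: int_induct[where k = 0])
    case base
    then show ?case using 0 that by simp
  next
    case (step1 i)
    then show ?case using add[OF step1(2) that] by (simp add: vector_sadd_rdistrib)
  next
    case (step2 i)
    then show ?case using diff[OF step2(2) that] by (simp add: vector_sub_rdistrib)
  qed
qed

lemma subgroup_lat: "subgroup (lat A) Z2"
proof -
  have "0 v* A \<in> lat A"
    unfolding lat_def by (rule rangeI)
  moreover have "v v* A - w v* A \<in> lat A" for v w
    unfolding lat_def by (metis rangeI vector_matrix_mult_diff_distrib)
  ultimately show ?thesis
    by (auto simp: subgroup_Z2_iff) (auto simp: lat_def)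
qed

lemma rcoset_Z2_eq_iff:
  assumes "subgroup L Z2"
  shows "L #>\<^bsub>Z2\<^esub> g = L #>\<^bsub>Z2\<^esub> g' \<longleftrightarrow> g - g' \<in> L"
proof
  assume "L #>\<^bsub>Z2\<^esub> g = L #>\<^bsub>Z2\<^esub> g'"
  moreover have "0 + g \<in> L #>\<^bsub>Z2\<^esub> g"
    using subgroup_Z2_closed(1)[OF assms] by (force simp: r_coset_def)
  ultimately show "g - g' \<in> L"
    by (auto simp: r_coset_def)
next
  assume *: "g - g' \<in> L"
  have "x \<in> L #>\<^bsub>Z2\<^esub> g \<longleftrightarrow> x - g \<in> L" for x g
    by (auto simp: r_coset_def intro: bexI[of _ "x - g"])
  moreover have "x - g \<in> L \<longleftrightarrow> x - g' \<in> L" for x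
    using subgroup_Z2_closed(2)[OF assms _ *, of "x - g'"]
      subgroup_Z2_closed(3)[OF assms _ *, of "x - g"] by auto
  ultimately show "L #>\<^bsub>Z2\<^esub> g = L #>\<^bsub>Z2\<^esub> g'"
    by blast
qed

text \<open>The generator is the least positive element; a nonzero remainder modulo it would be a
  smaller one.\<close>

lemma int_subgroup_principal:
  fixes I :: "int set"
  assumes "m \<in> I" "m > 0" and diff: "\<And>x y. x \<in> I \<Longrightarrow> y \<in> I \<Longrightarrow> x - y \<in> I"
  obtains a where "a > 0" "I = {x. a dvd x}"
proof -
  define a where "a = (LEAST k. k > 0 \<and> int k \<in> I)"
  have ex: "\<exists>k. k > 0 \<and> int k \<in> I"
    using assms(1,2) by (intro exI[of _ "nat m"]) simp
  have a: "a > 0" "int a \<in> I"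
    using LeastI_ex[OF ex] by (auto simp: a_def)
  have 0: "0 \<in> I"
    using diff[OF a(2) a(2)] by simp
  have add: "x + y \<in> I" if "x \<in> I" "y \<in> I" for x y
    using diff[OF that(1) diff[OF 0 that(2)]] by simp
  have mult: "k * int a \<in> I" for k
  proof (induction k rule: int_induct[where k = 0])
    case (step1 i)
    then show ?case using add[OF step1(2) a(2)] by (simp add: algebra_simps)
  next
    case (step2 i)
    then show ?case using diff[OF step2(2) a(2)] by (simp add: algebra_simps)
  qed (simp add: 0)
  have "int a dvd x" if "x \<in> I" for x
  proof (rule ccontr)
    assume "\<not> int a dvd x"
    then have pos: "x mod int a > 0"
      using a(1) by (simp add: mod_int_pos_iff dvd_eq_mod_eq_0 order.not_eq_order_implies_strict)
    have "x - x div int a * int a \<in> I"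
      using diff[OF that mult] .
    then have "int (nat (x mod int a)) \<in> I"
      using pos by (simp add: minus_div_mult_eq_mod)
    then have "a \<le> nat (x mod int a)"
      using pos unfolding a_def by (intro Least_le) simp
    then show False
      using a(1) pos by (metis le_nat_iff not_le of_nat_0_less_iff order_less_imp_le pos_mod_bound)
  qed
  then have "I = {x. int a dvd x}"
    using mult by (auto simp: dvd_def mult.commute)
  with a(1) show thesis by (intro that[of "int a"]) auto
qed

text \<open>Hermite normal form: \<open>a\<close> generates the first coordinates of vectors of
  \<open>L\<close>, \<open>d\<close> generates the part of \<open>L\<close> on the second axis, and
  \<open>b\<close> completes \<open>a\<close> to a vector of \<open>L\<close>.\<close>

lemma subgroup_Z2_hermite:
  assumes L: "subgroup L Z2" and m: "m > 0" "\<And>v. m *s v \<in> L"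
  obtains a d b where "a > 0" "d > 0" "L = lat (mat2 a b 0 d)"
proof -
  note closed = subgroup_Z2_closed[OF L]
  define I where "I = (\<lambda>v. v $ 1) ` L"
  have "m \<in> I"
    using m(2)[of "vec2 1 0"] by (force simp: I_def)
  moreover have "x - y \<in> I" if "x \<in> I" "y \<in> I" for x y
    using that closed(2) by (auto simp: I_def) (metis image_eqI vector_minus_component)
  ultimately obtain a where a: "a > 0" "I = {x. a dvd x}"
    using int_subgroup_principal m(1) by metis
  define J where "J = {y. vec2 0 y \<in> L}"
  have sub: "vec2 0 x - vec2 0 y = vec2 0 (x - y)" "k *s vec2 0 x = vec2 0 (k * x)" for x y k
    by (simp_all add: coords_2)
  have "m \<in> J"
    using m(2)[of "vec2 0 1"] by (simp add: J_def sub)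
  moreover have "x - y \<in> J" if "x \<in> J" "y \<in> J" for x y
    using that closed(2) unfolding J_def by (metis mem_Collect_eq sub(1))
  ultimately obtain d where d: "d > 0" "J = {x. d dvd x}"
    using int_subgroup_principal m(1) by metis
  have "a \<in> I"
    using a by simp
  then obtain u where u: "u \<in> L" "u $ 1 = a"
    by (auto simp: I_def)
  define b where "b = u $ 2"
  have "v \<in> L \<longleftrightarrow> v \<in> lat (mat2 a b 0 d)" for v
  proof
    assume v: "v \<in> L"
    then have "v $ 1 \<in> I"
      by (auto simp: I_def)
    then obtain t where t: "v $ 1 = a * t"
      using a by auto
    have "v - t *s u = vec2 0 (v $ 2 - t * b)"
      using t u by (simp add: coords_2 b_def)
    then have "v $ 2 - t * b \<in> J"
      using closed(2)[OF v closed(4)[OF u(1)], of t] by (simp add: J_def)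
    then obtain s where "v $ 2 - t * b = d * s"
      using d by auto
    then have "v = vec2 t s v* mat2 a b 0 d"
      using t by (simp add: coords_2 algebra_simps)
    then show "v \<in> lat (mat2 a b 0 d)"
      by (simp add: lat_def)
  next
    assume "v \<in> lat (mat2 a b 0 d)"
    then obtain w where w: "v = w v* mat2 a b 0 d"
      by (auto simp: lat_def)
    have "v = w $ 1 *s u + w $ 2 *s vec2 0 d"
      using w u by (simp add: coords_2 b_def algebra_simps)
    moreover have "d \<in> J"
      using d by simp
    then have "vec2 0 d \<in> L"
      by (simp add: J_def)
    ultimately show "v \<in> L"
      using closed(3)[OF closed(4)[OF u(1)] closed(4)[of "vec2 0 d"]] by metis
  qed
  then have "L = lat (mat2 a b 0 d)"
    by blast
  with a(1) d(1) show thesis by (rule that)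
qed

text \<open>The integral points of the box \<open>{0..<a} \<times> {0..<d}\<close> represent each
  coset exactly once.\<close>

lemma index_hermite:
  assumes "a > 0" "d > 0"
  shows "card (rcosets\<^bsub>Z2\<^esub> (lat (mat2 a b 0 d))) = nat (a * d)"
proof -
  let ?L = "lat (mat2 a b 0 d)"
  let ?f = "\<lambda>(i, j). ?L #>\<^bsub>Z2\<^esub> vec2 i j"
  have L: "v \<in> ?L \<longleftrightarrow> (\<exists>x y. v $ 1 = x * a \<and> v $ 2 = x * b + y * d)" for v
  proof
    assume "\<exists>x y. v $ 1 = x * a \<and> v $ 2 = x * b + y * d"
    then obtain x y where "v $ 1 = x * a" "v $ 2 = x * b + y * d" by blast
    then have "v = vec2 x y v* mat2 a b 0 d"
      by (simp add: coords_2 algebra_simps)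
    then show "v \<in> ?L" by (simp add: lat_def)
  qed (auto simp: lat_def coords_2 algebra_simps)
  note eq_iff = rcoset_Z2_eq_iff[OF subgroup_lat]
  have "inj_on ?f ({0..<a} \<times> {0..<d})"
  proof (rule inj_onI, clarify)
    fix i j i' j'
    assume ij: "i \<in> {0..<a}" "j \<in> {0..<d}" "i' \<in> {0..<a}" "j' \<in> {0..<d}"
      and "?L #>\<^bsub>Z2\<^esub> vec2 i j = ?L #>\<^bsub>Z2\<^esub> vec2 i' j'"
    then obtain x y where xy: "i - i' = x * a" "j - j' = x * b + y * d"
      by (auto simp: eq_iff L)
    have small: "k = 0" if "\<bar>k * c\<bar> < c" for k c :: int
    proof (rule ccontr)
      assume "k \<noteq> 0"
      then have "1 * \<bar>c\<bar> \<le> \<bar>k\<bar> * \<bar>c\<bar>"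
        by (intro mult_right_mono) auto
      then show False
        using that by (simp only: abs_mult)
    qed
    \<comment> \<open>Triangular shape decides the order: the first coordinate forces
      \<open>x = 0\<close>, after which the second involves only \<open>y * d\<close>.\<close>
    have "x = 0"
      using xy(1) ij by (intro small[of x a]) auto
    moreover from this have "y = 0"
      using xy(2) ij by (intro small[of y d]) auto
    ultimately show "i = i' \<and> j = j'"
      using xy by simp
  qed
  moreover have "?f ` ({0..<a} \<times> {0..<d}) = rcosets\<^bsub>Z2\<^esub> ?L"
  proof (intro equalityI subsetI)
    fix C assume "C \<in> rcosets\<^bsub>Z2\<^esub> ?L"
    then obtain g where g: "C = ?L #>\<^bsub>Z2\<^esub> g"
      by (auto simp: RCOSETS_def)
    define i where "i = g $ 1 mod a"
    \<comment> \<open>The second coordinate left over after a multiple of the first row has reduced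
      the first coordinate modulo \<open>a\<close>.\<close>
    define r where "r = g $ 2 - g $ 1 div a * b"
    have "g - vec2 i (r mod d) \<in> ?L"
      unfolding L
    proof (intro exI conjI)
      show "(g - vec2 i (r mod d)) $ 1 = (g $ 1 div a) * a"
        by (simp add: i_def minus_mod_eq_div_mult)
      show "(g - vec2 i (r mod d)) $ 2 = (g $ 1 div a) * b + (r div d) * d"
        using minus_mod_eq_div_mult[of r d] by (simp add: r_def)
    qed
    then have "C = ?f (i, r mod d)"
      by (simp add: g eq_iff)
    moreover have "(i, r mod d) \<in> {0..<a} \<times> {0..<d}"
      using assms by (simp add: i_def)
    ultimately show "C \<in> ?f ` ({0..<a} \<times> {0..<d})"
      by blast
  qed (auto simp: RCOSETS_def)
  ultimately have "card (rcosets\<^bsub>Z2\<^esub> ?L) = card ({0..<a} \<times> {0..<d})"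
    using card_image[of ?f "{0..<a} \<times> {0..<d}"] by simp
  then show ?thesis
    using assms by (simp add: nat_mult_distrib)
qed

lemma finite_index_scaled:
  assumes L: "subgroup L Z2" and fin: "finite (rcosets\<^bsub>Z2\<^esub> L)"
  obtains m where "m > 0" "m *s v \<in> L"
proof -
  let ?f = "\<lambda>k::nat. L #>\<^bsub>Z2\<^esub> (int k *s v)"
  have "range ?f \<subseteq> rcosets\<^bsub>Z2\<^esub> L"
    by (auto simp: RCOSETS_def)
  then have "\<not> inj ?f"
    using fin by (meson finite_subset range_inj_infinite)
  then obtain i j where "i < j" "?f i = ?f j"
    unfolding inj_def by (metis linorder_neqE_nat)
  then have "int j *s v - int i *s v \<in> L"
    by (metis rcoset_Z2_eq_iff[OF L])
  then have "(int j - int i) *s v \<in> L"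
    by (simp add: vector_sub_rdistrib)
  then show thesis
    using \<open>i < j\<close> by (intro that[of "int j - int i"]) auto
qed

text \<open>Bridge from index to determinant. Both directions pass through a Hermite basis, whose
  index is known; for an arbitrary basis the change of basis has determinant 1.\<close>

lemma sublattices_eq:
  assumes "N > 0"
  shows "sublattices N = {lat A | A. det A = int N}"
proof (intro equalityI subsetI)
  fix L assume "L \<in> sublattices N"
  then have L: "subgroup L Z2" and card: "card (rcosets\<^bsub>Z2\<^esub> L) = N"
    by (auto simp: sublattices_def)
  then have fin: "finite (rcosets\<^bsub>Z2\<^esub> L)"
    using assms by (intro card_ge_0_finite) simp
  obtain k where k: "k > 0" "k *s vec2 1 0 \<in> L"
    using finite_index_scaled[OF L fin] .
  obtain l where l: "l > 0" "l *s vec2 0 1 \<in> L"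
    using finite_index_scaled[OF L fin] .
  \<comment> \<open>Finite index gives multiples of both unit vectors in \<open>L\<close>; their
    product scales every vector into \<open>L\<close>, as the Hermite form requires.\<close>
  have "(k * l) *s v \<in> L" for v
  proof -
    have "(k * l) *s v = (l * v $ 1) *s (k *s vec2 1 0) + (k * v $ 2) *s (l *s vec2 0 1)"
      by (simp add: coords_2)
    then show ?thesis
      using subgroup_Z2_closed(3,4)[OF L] k l by simp
  qed
  then obtain a b d where "a > 0" "d > 0" "L = lat (mat2 a b 0 d)"
    using subgroup_Z2_hermite[OF L mult_pos_pos[OF k(1) l(1)]] by blast
  moreover from this have "N = nat (a * d)"
    using card index_hermite by metis
  ultimately show "L \<in> {lat A | A. det A = int N}"
    by (auto simp: det_2 intro!: exI[of _ "mat2 a b 0 d"])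
next
  fix L assume "L \<in> {lat A | A. det A = int N}"
  then obtain A where A: "L = lat A" "det A = int N"
    by blast
  have N: "int N > 0" and scaled: "\<And>v. int N *s v \<in> lat A"
    using assms A(2) det_scaled_in_lat[of A] by simp_all
  obtain a d b where H: "a > 0" "d > 0" "lat A = lat (mat2 a b 0 d)"
    using subgroup_Z2_hermite[OF subgroup_lat N scaled] .
  have det: "det (mat2 a b 0 d) = a * d"
    by (simp add: det_2)
  then have "det A > 0" "det (mat2 a b 0 d) > 0"
    using A(2) assms H(1,2) by simp_all
  then obtain C where "det C = 1" "A = C ** mat2 a b 0 d"
    using lat_eqE[OF H(3)] by blast
  then have "det A = a * d"
    by (simp only: det_mul det)
  then show "L \<in> sublattices N"
    using A H index_hermite[of a d b] by (simp add: sublattices_def subgroup_lat)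
qed

text \<open>A sublattice of index \<open>N\<close> contains all multiples of \<open>N\<close>, so it
  is determined by its points in an \<open>N\<close> by \<open>N\<close> box.\<close>

lemma finite_sublattices:
  assumes "N > 0"
  shows "finite (sublattices N)"
proof -
  let ?red = "\<lambda>v :: int^2. vec2 (v $ 1 mod int N) (v $ 2 mod int N)"
  let ?box = "(\<lambda>(x, y). vec2 x y) ` ({0..<int N} \<times> {0..<int N})"
  have red: "?red v \<in> ?box" for v
    using assms by (auto intro!: image_eqI[of _ _ "(v $ 1 mod int N, v $ 2 mod int N)"])
  have mem: "v \<in> L \<longleftrightarrow> ?red v \<in> L" if L: "L \<in> sublattices N" for L v
  proof -
    obtain A where A: "L = lat A" "det A = int N"
      using L unfolding sublattices_eq[OF assms] by blast
    define u where "u = int N *s vec2 (v $ 1 div int N) (v $ 2 div int N)"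
    have "u \<in> L"
      using A det_scaled_in_lat[of A] by (simp add: u_def)
    moreover have "v = ?red v + u" "?red v = v - u"
      by (simp_all add: u_def coords_2 minus_mult_div_eq_mod)
    ultimately show ?thesis
      using subgroup_Z2_closed(2)[OF subgroup_lat, of v A u]
        subgroup_Z2_closed(3)[OF subgroup_lat, of "?red v" A u] A(1) by metis
  qed
  have "inj_on (\<lambda>L. L \<inter> ?box) (sublattices N)"
  proof (rule inj_onI)
    fix L L' assume LL': "L \<in> sublattices N" "L' \<in> sublattices N" "L \<inter> ?box = L' \<inter> ?box"
    have "v \<in> L \<longleftrightarrow> v \<in> L'" for v
      using mem[OF LL'(1), of v] mem[OF LL'(2), of v] red[of v] LL'(3) by blast
    then show "L = L'" by blast
  qed
  then show ?thesis
    by (rule inj_on_finite[of _ _ "Pow ?box"]) auto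
qed

section \<open>The action of the modular group on lattices\<close>

lemma SL2Z_simps [simp]: "A \<in> carrier SL2Z \<longleftrightarrow> det A = 1" "A \<otimes>\<^bsub>SL2Z\<^esub> B = A ** B"
    "\<one>\<^bsub>SL2Z\<^esub> = mat 1"
  by (simp_all add: SL2Z_def)

interpretation SL2Z: group SL2Z
  by (rule group_SL2Z)

lemma lattice_act_mult: "lattice_act (A ** B) L = lattice_act B (lattice_act A L)"
  by (simp add: lattice_act_def image_image vector_matrix_mul_assoc)

interpretation SL2Z: right_action SL2Z lattice_act
proof
  show "lattice_act \<one>\<^bsub>SL2Z\<^esub> L = L" for L
    by (simp add: lattice_act_def)
qed (simp add: lattice_act_mult)

lemma lattice_act_sublattices:
  assumes "det A = int k" "k > 0" "N > 0" "L \<in> sublattices N"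
  shows "lattice_act A L \<in> sublattices (N * k)"
proof -
  obtain B where "L = lat B" "det B = int N"
    using assms(4) unfolding sublattices_eq[OF assms(3)] by blast
  then have "lattice_act A L = lat (B ** A)" "det (B ** A) = int (N * k)"
    using assms(1) by (simp_all add: lattice_act_lat det_mul)
  then show ?thesis
    using assms sublattices_eq[of "N * k"] by auto
qed

lemma orbit_sublattices_subset:
  assumes "N > 0" "L \<in> sublattices N"
  shows "orbit SL2Z lattice_act L \<subseteq> sublattices N"
  using lattice_act_sublattices[of _ 1 N L] assms by (auto simp: orbit_def)

lemma finite_orbit_sublattice:
  assumes "N > 0" "L \<in> sublattices N"
  shows "finite (orbit SL2Z lattice_act L)"
  using orbit_sublattices_subset[OF assms] finite_sublattices[OF assms(1)] by (rule finite_subset)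

lemma inj_lattice_act:
  assumes "det A \<noteq> 0"
  shows "inj (lattice_act A)"
proof -
  have "inj (\<lambda>v. v v* A)"
  proof (rule injI)
    fix v w assume "v v* A = w v* A"
    then have "v v* mat (det A) = w v* mat (det A)"
      by (metis vector_matrix_mul_assoc mult_adj2(1))
    then show "v = w"
      using assms by (simp add: coords_2)
  qed
  then show ?thesis
    unfolding lattice_act_def by (simp add: inj_def inj_image_eq_iff)
qed

text \<open>
  The class \<open>[A \<gamma> A\<inverse>]\<close>, where the rows of \<open>A\<close> form any positively oriented basis of \<open>L\<close>; ranging over
  all such bases produces the whole conjugacy class at once.
\<close>

definition lattice_class :: "(int^2) set \<Rightarrow> int^2^2 \<Rightarrow> (int^2^2) set" where
  "lattice_class L \<gamma> = {B. \<exists>A. det A > 0 \<and> L = lat A \<and> B ** A = A ** \<gamma>}"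

text \<open>Every other oriented basis is \<open>C ** A\<close> with \<open>det C = 1\<close>, and
  passing to it conjugates \<open>B\<close> by \<open>C\<close>.\<close>

lemma lattice_class_eq:
  assumes A: "det A > 0" and B: "B ** A = A ** \<gamma>" "det B = 1"
  shows "lattice_class (lat A) \<gamma> = conj_class SL2Z B"
proof (intro equalityI subsetI)
  fix B' assume "B' \<in> lattice_class (lat A) \<gamma>"
  then obtain A' where A': "det A' > 0" "lat A = lat A'" "B' ** A' = A' ** \<gamma>"
    by (auto simp: lattice_class_def)
  obtain C where C: "det C = 1" "A' = C ** A"
    using lat_eqE[OF A'(2)[symmetric] A'(1) A] .
  have "B' ** C ** A = C ** A ** \<gamma>"
    using A'(3) C by (simp add: matrix_mul_assoc)
  also have "\<dots> = C ** B ** A"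
    using B(1) by (metis matrix_mul_assoc)
  finally have BC: "B' ** C = C ** B"
    using mult_right_cancel_2 A by force
  have "conj_act SL2Z C B = B'"
  proof -
    have "conj_act SL2Z C B = B' \<otimes>\<^bsub>SL2Z\<^esub> C \<otimes>\<^bsub>SL2Z\<^esub> inv\<^bsub>SL2Z\<^esub> C"
      using BC by (simp add: conj_act_def)
    moreover have "det B' = 1"
      using arg_cong[OF BC, of det] B(2) C(1) by (simp add: det_mul)
    ultimately show ?thesis
      using C(1) SL2Z.m_assoc[of B' C "inv\<^bsub>SL2Z\<^esub> C"] SL2Z.r_inv[of C] SL2Z.inv_closed[of C]
      by (simp del: SL2Z_simps add: SL2Z_simps(1))
  qed
  then show "B' \<in> conj_class SL2Z B"
    using C(1) by (force simp: conj_class_def orbit_def)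
next
  fix B' assume "B' \<in> conj_class SL2Z B"
  then obtain C where C: "det C = 1" "B' = conj_act SL2Z C B"
    by (auto simp: conj_class_def orbit_def)
  have "B' ** C = C ** B \<otimes>\<^bsub>SL2Z\<^esub> (inv\<^bsub>SL2Z\<^esub> C \<otimes>\<^bsub>SL2Z\<^esub> C)"
    by (simp add: C(2) conj_act_def matrix_mul_assoc)
  also have "\<dots> = C ** B"
    using C(1) SL2Z.l_inv[of C] by simp
  finally have "B' ** (C ** A) = (C ** A) ** \<gamma>"
    using B(1) by (metis matrix_mul_assoc)
  moreover have "det (C ** A) > 0" "lat A = lat (C ** A)"
    using A C(1) by (simp_all add: det_mul lat_mult_SL2)
  ultimately show "B' \<in> lattice_class (lat A) \<gamma>"
    by (auto simp: lattice_class_def)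
qed

text \<open>If \<open>A\<close> is a basis of \<open>L\<close>, then \<open>A ** g\<close> is a
  basis of the translated lattice, and conjugating \<open>\<gamma>\<close> by it gives the same
  matrix as conjugating \<open>g \<gamma> g\<^sup>-\<^sup>1\<close> by \<open>A\<close>.\<close>

lemma lattice_class_conj_act:
  assumes g: "det g = 1" and \<gamma>: "det \<gamma> = 1"
  shows "lattice_class L (conj_act SL2Z g \<gamma>) = lattice_class (lattice_act g L) \<gamma>"
proof -
  let ?h = "inv\<^bsub>SL2Z\<^esub> g"
  have h: "det ?h = 1" "g ** ?h = mat 1" "?h ** g = mat 1"
    using g SL2Z.inv_closed[of g] SL2Z.r_inv[of g] SL2Z.l_inv[of g] by simp_all
  have "B ** A = A ** conj_act SL2Z g \<gamma> \<longleftrightarrow> B ** (A ** g) = (A ** g) ** \<gamma>" for A B :: "int^2^2"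
  proof
    assume "B ** A = A ** conj_act SL2Z g \<gamma>"
    then have "B ** (A ** g) = A ** g ** \<gamma> ** (?h ** g)"
      by (simp add: conj_act_def matrix_mul_assoc)
    then show "B ** (A ** g) = (A ** g) ** \<gamma>"
      by (simp add: h)
  next
    assume "B ** (A ** g) = (A ** g) ** \<gamma>"
    then have "B ** A ** (g ** ?h) = A ** conj_act SL2Z g \<gamma>"
      by (simp add: conj_act_def matrix_mul_assoc)
    then show "B ** A = A ** conj_act SL2Z g \<gamma>"
      by (simp add: h)
  qed
  moreover have "L = lat A \<longleftrightarrow> lattice_act g L = lat (A ** g)" for A
    using inj_lattice_act[of g] g by (simp add: inj_eq flip: lattice_act_lat)
  ultimately have "(det A > 0 \<and> L = lat A \<and> B ** A = A ** conj_act SL2Z g \<gamma>)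
      \<longleftrightarrow> (det (A ** g) > 0 \<and> lattice_act g L = lat (A ** g) \<and> B ** (A ** g) = (A ** g) ** \<gamma>)" for A B
    by (simp only: det_mul g mult_1_right)
  \<comment> \<open>Right multiplication by \<open>g\<close> permutes all integral matrices, so the
    quantified basis may be replaced by its translate.\<close>
  moreover have "(\<exists>A. P (A ** g)) \<longleftrightarrow> (\<exists>A. P A)" for P :: "int^2^2 \<Rightarrow> bool"
    by (metis h(3) matrix_mul_assoc matrix_mul_rid)
  note this[of "\<lambda>A. det A > 0 \<and> lattice_act g L = lat A \<and> B ** A = A ** \<gamma>" for B]
  ultimately show ?thesis
    by (simp only: lattice_class_def)
qed

lemma lat_fixE:
  assumes "det A > 0" "det \<gamma> = 1" "lattice_act \<gamma> (lat A) = lat A"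
  obtains B where "det B = 1" "B ** A = A ** \<gamma>"
proof -
  have "det (A ** \<gamma>) > 0" "lat (A ** \<gamma>) = lat A"
    using assms by (simp_all add: det_mul lattice_act_lat)
  then obtain B where "det B = 1" "A ** \<gamma> = B ** A"
    using lat_eqE assms(1) by metis
  then show thesis by (intro that) simp_all
qed

lemma basis_matrix:
  assumes "N > 0" "L \<in> sublattices N"
  shows "det (basis_matrix N L) = int N" "L = lat (basis_matrix N L)"
proof -
  have "\<exists>A. det A = int N \<and> L = range (\<lambda>v. v v* A)"
    using assms(2) unfolding sublattices_eq[OF assms(1)] lat_def by blast
  then have "det (basis_matrix N L) = int N \<and> L = range (\<lambda>v. v v* basis_matrix N L)"
    unfolding basis_matrix_def by (rule someI_ex)
  then show "det (basis_matrix N L) = int N" "L = lat (basis_matrix N L)"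
    by (simp_all add: lat_def)
qed

text \<open>An integral solution exists because \<open>A\<close> and \<open>A ** \<gamma>\<close>
  are bases of the same lattice. Over the rationals it meets the defining equation, and injectivity
  of the entrywise embedding makes it the unique one.\<close>

lemma lattice_hom:
  assumes N: "N > 0" and L: "L \<in> sublattices N" and \<gamma>: "\<gamma> \<in> stabilizer SL2Z lattice_act L"
  shows "lattice_hom N L \<gamma> ** basis_matrix N L = basis_matrix N L ** \<gamma>" "det (lattice_hom N L \<gamma>) = 1"
proof -
  define A where "A = basis_matrix N L"
  let ?q = "map_matrix rat_of_int"
  have A: "det A = int N" "L = lat A"
    using basis_matrix[OF N L] by (simp_all add: A_def)
  have "det A > 0" "det \<gamma> = 1" "lattice_act \<gamma> (lat A) = lat A"
    using A N \<gamma> by (simp_all add: stabilizer_def)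
  then obtain B where B: "det B = 1" "B ** A = A ** \<gamma>"
    using lat_fixE by blast
  have q_mult: "?q (X ** Y) = ?q X ** ?q Y" for X Y :: "int^2^2"
    by (simp add: coords_2)
  have q_inj: "?q X = ?q Y \<longleftrightarrow> X = Y" for X Y :: "int^2^2"
    by (simp add: vec_eq_iff)
  have "det (?q A) = rat_of_int (det A)"
    by (simp add: det_2)
  then have "invertible (?q A)"
    using A N by (simp add: invertible_det_nz)
  then have "?q A ** matrix_inv (?q A) = mat 1"
    unfolding invertible_def matrix_inv_def by (rule someI2_ex) simp
  moreover have "?q A ** ?q \<gamma> = ?q B ** ?q A"
    by (simp only: B(2) flip: q_mult)
  ultimately have "?q A ** ?q \<gamma> ** matrix_inv (?q A) = ?q B"
    by (simp flip: matrix_mul_assoc)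
  then have "lattice_hom N L \<gamma> = B"
    by (simp add: lattice_hom_def q_inj flip: A_def)
  then show "lattice_hom N L \<gamma> ** basis_matrix N L = basis_matrix N L ** \<gamma>" "det (lattice_hom N L \<gamma>) = 1"
    using B by (simp_all add: A_def)
qed

section \<open>Sublattices of prime index\<close>

text \<open>The determinant of the matrix with rows \<open>v\<close> and \<open>w\<close>; if it is
  divisible by \<open>p\<close>, the two vectors are linearly dependent modulo
  \<open>p\<close>.\<close>

definition wedge :: "int^2 \<Rightarrow> int^2 \<Rightarrow> int" where
  "wedge v w = v $ 1 * w $ 2 - v $ 2 * w $ 1"

abbreviation scaled :: "nat \<Rightarrow> (int^2) set" where
  "scaled p \<equiv> {v. int p dvd v $ 1 \<and> int p dvd v $ 2}"

abbreviation column :: "nat \<Rightarrow> (int^2) set" where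
  "column p \<equiv> {v. int p dvd v $ 1}"

lemma wedge_mult: "wedge (s v* A) (t v* A) = wedge s t * det A"
  by (simp add: wedge_def coords_2 algebra_simps)

lemma scaled_eq: "v \<in> scaled p \<longleftrightarrow> (\<exists>w. v = int p *s w)"
proof
  assume "v \<in> scaled p"
  then obtain x y where "v $ 1 = int p * x" "v $ 2 = int p * y"
    by (auto elim!: dvdE)
  then have "v = int p *s vec2 x y"
    by (simp add: coords_2)
  then show "\<exists>w. v = int p *s w" ..
qed auto

lemma lat_mat: "lat (mat (int p)) = scaled p"
proof -
  have "v v* mat (int p) = int p *s v" for v :: "int^2"
    by (simp add: coords_2)
  then have "v \<in> lat (mat (int p)) \<longleftrightarrow> v \<in> scaled p" for v
    by (simp only: scaled_eq lat_def) blast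
  then show ?thesis
    by blast
qed

lemma det_mat_2: "det (mat k :: int^2^2) = k * k"
  by (simp add: det_2 mat_def)

lemma scaled_subset_sublattice:
  assumes "N > 0" "L \<in> sublattices N"
  shows "scaled N \<subseteq> L"
proof
  fix v assume "v \<in> scaled N"
  then obtain w where "v = int N *s w"
    using scaled_eq by blast
  moreover obtain A where "L = lat A" "det A = int N"
    using assms(2) unfolding sublattices_eq[OF assms(1)] by blast
  ultimately show "v \<in> L"
    using det_scaled_in_lat[of A w] by simp
qed

lemma column_eq_lat: "column p = lat (mat2 (int p) 0 0 1)"
proof (intro equalityI subsetI)
  fix v :: "int^2" assume "v \<in> column p"
  then obtain x where "v $ 1 = int p * x"
    by auto
  then have "v = vec2 x (v $ 2) v* mat2 (int p) 0 0 1"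
    by (simp add: coords_2)
  then show "v \<in> lat (mat2 (int p) 0 0 1)"
    unfolding lat_def by blast
next
  fix v assume "v \<in> lat (mat2 (int p) 0 0 1)"
  then show "v \<in> column p"
    by (auto simp: lat_def coords_2)
qed

text \<open>The vector (0, 1) lies in \<open>column p\<close> and is sent to the second row of
  \<open>\<gamma>\<close>. Conversely, divisibility gives an inclusion of lattices, which equal
  determinants turn into an equality.\<close>

lemma stabilizer_column:
  assumes "p > 0"
  shows "stabilizer SL2Z lattice_act (column p) = Gamma0 p"
proof -
  have "lattice_act \<gamma> (column p) = column p \<longleftrightarrow> int p dvd \<gamma> $ 2 $ 1" if \<gamma>: "det \<gamma> = 1" for \<gamma>
  proof
    assume "lattice_act \<gamma> (column p) = column p"
    moreover have "vec2 0 1 v* \<gamma> \<in> lattice_act \<gamma> (column p)"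
      unfolding lattice_act_def by (rule imageI) simp
    ultimately have "vec2 0 1 v* \<gamma> \<in> column p"
      by simp
    then show "int p dvd \<gamma> $ 2 $ 1"
      by (simp add: coords_2)
  next
    let ?D = "mat2 (int p) 0 0 1"
    assume dvd: "int p dvd \<gamma> $ 2 $ 1"
    then have "lattice_act \<gamma> (column p) \<subseteq> column p"
      by (auto simp: lattice_act_def coords_2)
    then have "lat (?D ** \<gamma>) \<subseteq> lat ?D"
      by (simp only: column_eq_lat lattice_act_lat)
    moreover have "det (?D ** \<gamma>) = det ?D" "det ?D \<noteq> 0"
      using \<gamma> assms by (simp_all only: det_mul) (simp_all add: det_2)
    ultimately have "lat (?D ** \<gamma>) = lat ?D"
      by (rule lat_subset_det_eq)
    then show "lattice_act \<gamma> (column p) = column p"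
      by (simp only: column_eq_lat lattice_act_lat)
  qed
  then show ?thesis
    by (auto simp: stabilizer_def Gamma0_def)
qed

context
  fixes p :: nat
  assumes p: "prime p"
begin

lemma p_pos: "p > 0"
  using p prime_gt_0_nat by blast

lemma column_in_sublattices: "column p \<in> sublattices p"
  unfolding sublattices_eq[OF p_pos] column_eq_lat
  by (auto intro!: exI[of _ "mat2 (int p) 0 0 1"] simp: det_2)

text \<open>Modulo \<open>p\<close> such a lattice is a line in the plane over the field with
  \<open>p\<close> elements, so any of its vectors that is nonzero modulo \<open>p\<close>
  determines it.\<close>

lemma prime_index_eq:
  assumes M: "M \<in> sublattices p" and v: "v \<in> M" "v \<notin> scaled p"
  shows "M = {w. int p dvd wedge v w}"
proof (intro equalityI subsetI)
  obtain A where A: "M = lat A" "det A = int p"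
    using M unfolding sublattices_eq[OF p_pos] by blast
  obtain s where s: "v = s v* A"
    using v A by (auto simp: lat_def)
  fix w
  {
    assume "w \<in> M"
    then obtain t where "w = t v* A"
      using A by (auto simp: lat_def)
    then show "w \<in> {w. int p dvd wedge v w}"
      by (simp add: s wedge_mult A)
  next
    assume "w \<in> {w. int p dvd wedge v w}"
    then obtain k where k: "v $ 1 * w $ 2 - v $ 2 * w $ 1 = int p * k"
      by (auto simp: wedge_def)
    obtain i where i: "\<not> int p dvd v $ i"
      using v(2) by auto
    then have "coprime (v $ i) (int p)"
      using p by (simp add: prime_imp_coprime coprime_commute)
    then obtain a b where ab: "a * v $ i + b * int p = 1"
      using bezout_int[of "v $ i" "int p"] by (auto simp: coprime_iff_gcd_eq_1)
    \<comment> \<open>By the Bezout relation \<open>a\<close> inverts \<open>v $ i\<close> modulo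
      \<open>p\<close>, so this factor makes the \<open>i\<close>-th coordinates agree; the
      vanishing wedge takes care of the other one.\<close>
    have "w - (a * w $ i) *s v \<in> scaled p"
    proof -
      have "w $ 1 * v $ i - w $ i * v $ 1 \<in> {0, - int p * k, int p * k}"
           "w $ 2 * v $ i - w $ i * v $ 2 \<in> {0, - int p * k, int p * k}"
        using k exhaust_2[of i] by (auto simp: algebra_simps)
      then have "int p dvd w $ j * v $ i - w $ i * v $ j" for j
        using exhaust_2[of j] by auto
      moreover have "(w - (a * w $ i) *s v) $ j
          = a * (w $ j * v $ i - w $ i * v $ j) + int p * (b * w $ j)" for j
        using arg_cong[OF ab, of "\<lambda>x. x * w $ j"] by (simp add: algebra_simps)
      ultimately show ?thesis by simp
    qed
    then have "w - (a * w $ i) *s v \<in> M"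
      using scaled_subset_sublattice[OF p_pos M] by blast
    then have "w - (a * w $ i) *s v + (a * w $ i) *s v \<in> M"
      using subgroup_Z2_closed(3,4)[OF subgroup_lat[of A]] v(1) A(1) by metis
    then show "w \<in> M" by simp
  }
qed

text \<open>Dividing \<open>v\<close> by its content, which is prime to \<open>p\<close>, gives a primitive vector, the second row of \<open>\<gamma>\<close>.\<close>

lemma wedge_lattice_in_orbit:
  assumes "v \<notin> scaled p"
  shows "{w. int p dvd wedge v w} \<in> orbit SL2Z lattice_act (column p)"
proof -
  define g where "g = gcd (v $ 1) (v $ 2)"
  have "\<not> int p dvd g"
    using assms by (simp add: g_def)
  then have "g \<noteq> 0" by auto
  obtain x y where xy: "v $ 1 = g * x" "v $ 2 = g * y"
    by (metis dvdE g_def gcd_dvd1 gcd_dvd2)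
  obtain s t where "s * v $ 1 + t * v $ 2 = g"
    using bezout_int g_def by blast
  then have "g * (s * x + t * y) = g * 1"
    by (simp add: xy algebra_simps)
  then have st: "s * x + t * y = 1"
    using \<open>g \<noteq> 0\<close> by simp
  define \<gamma> where "\<gamma> = mat2 t (- s) x y"
  have \<gamma>: "det \<gamma> = 1"
    using st by (simp add: \<gamma>_def det_2 algebra_simps)
  have dvd_iff: "int p dvd wedge v (u v* \<gamma>) \<longleftrightarrow> int p dvd u $ 1" for u
  proof -
    have "wedge v (u v* \<gamma>) = - g * u $ 1 * (s * x + t * y)"
      by (simp add: wedge_def \<gamma>_def coords_2 xy algebra_simps)
    then have "wedge v (u v* \<gamma>) = - (g * u $ 1)"
      by (simp add: st)
    then show ?thesis
      using p \<open>\<not> int p dvd g\<close> by (simp add: prime_dvd_mult_iff)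
  qed
  have "{w. int p dvd wedge v w} = lattice_act \<gamma> (column p)"
  proof (intro equalityI subsetI)
    fix w assume "w \<in> {w. int p dvd wedge v w}"
    moreover have "w = (w v* adj2 \<gamma>) v* \<gamma>"
      by (simp add: vector_matrix_mul_assoc mult_adj2 \<gamma>)
    ultimately show "w \<in> lattice_act \<gamma> (column p)"
      unfolding lattice_act_def using dvd_iff by (metis (mono_tags) image_eqI mem_Collect_eq)
  qed (auto simp: lattice_act_def dvd_iff)
  then show ?thesis
    using \<gamma> by (auto simp: orbit_def)
qed

text \<open>A lattice of index \<open>p\<close> is not inside \<open>scaled p\<close>, whose index
  is the square of \<open>p\<close>; hence it contains a vector to which the wedge description
  applies.\<close>

lemma orbit_column: "orbit SL2Z lattice_act (column p) = sublattices p"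
proof
  show "sublattices p \<subseteq> orbit SL2Z lattice_act (column p)"
  proof
    fix M assume M: "M \<in> sublattices p"
    then obtain A where A: "M = lat A" "det A = int p"
      unfolding sublattices_eq[OF p_pos] by blast
    have "\<not> M \<subseteq> scaled p"
    proof
      assume "M \<subseteq> scaled p"
      also have "scaled p = lat (mat (int p))"
        by (auto simp: lat_mat)
      finally obtain B where "A = B ** mat (int p)"
        using A lat_subset_iff by blast
      then have "det A = det B * (int p * int p)"
        by (simp add: det_mul det_mat_2)
      then have "det B * int p = 1"
        using A p_pos by simp
      then show False
        using p by (metis dvd_triv_right int_dvd_int_iff not_prime_unit of_nat_1)
    qed
    then obtain v where v: "v \<in> M" "v \<notin> scaled p" by blast
    show "M \<in> orbit SL2Z lattice_act (column p)"
      unfolding prime_index_eq[OF M v] by (rule wedge_lattice_in_orbit[OF v(2)])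
  qed
qed (rule orbit_sublattices_subset[OF p_pos column_in_sublattices])

text \<open>A vector of \<open>L\<close> outside \<open>scaled p\<close> pins down \<open>M\<close>.
  The resulting wedge lattice does contain \<open>L\<close>, since wedges of vectors of
  \<open>L\<close> are multiples of \<open>p ^ Suc n\<close>, where the exponent is
  positive.\<close>

lemma prime_superlattice_unique:
  assumes L: "L \<in> sublattices (p ^ Suc n)" "\<not> L \<subseteq> scaled p"
  shows "\<exists>!M. M \<in> sublattices p \<and> L \<subseteq> M"
proof -
  obtain v where v: "v \<in> L" "v \<notin> scaled p"
    using L by blast
  let ?M = "{w. int p dvd wedge v w}"
  have pow: "p ^ Suc n > 0"
    using p_pos by simp
  obtain A where A: "L = lat A" "det A = int (p ^ Suc n)"
    using L(1) unfolding sublattices_eq[OF pow] by blast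
  obtain s where s: "v = s v* A"
    using v A by (auto simp: lat_def)
  show ?thesis
  proof (rule ex1I[of _ ?M])
    have "int p dvd wedge v w" if "w \<in> L" for w
      using that A by (auto simp: lat_def s wedge_mult)
    then show "?M \<in> sublattices p \<and> L \<subseteq> ?M"
      using wedge_lattice_in_orbit[OF v(2)] orbit_column by auto
  next
    fix M assume "M \<in> sublattices p \<and> L \<subseteq> M"
    then show "M = ?M"
      using prime_index_eq v by blast
  qed
qed

end

section \<open>Hecke operators as sums over sublattices\<close>

context group
begin

lemma conj_act_mult:
  assumes "g \<in> carrier G" "h \<in> carrier G" "x \<in> carrier G"
  shows "conj_act G h (conj_act G g x) = conj_act G (h \<otimes> g) x"
  using assms by (simp add: conj_act_def inv_mult_group m_assoc)

lemma conj_class_eq: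
  assumes x: "x \<in> carrier G" and y: "y \<in> conj_class G x"
  shows "conj_class G y = conj_class G x"
proof -
  obtain g where g: "g \<in> carrier G" "y = conj_act G g x"
    using y by (auto simp: conj_class_def orbit_def)
  have "conj_act G h y = conj_act G (h \<otimes> g) x"
    and "conj_act G h x = conj_act G (h \<otimes> inv g) y" if "h \<in> carrier G" for h
    using that g x by (simp_all add: conj_act_mult m_assoc)
  then show ?thesis
    unfolding conj_class_def orbit_def using g(1) by blast
qed

lemma conj_class_refl: "x \<in> carrier G \<Longrightarrow> x \<in> conj_class G x"
  by (force simp: conj_class_def orbit_def conj_act_def intro!: exI[of _ \<one>])

text \<open>The assumption on \<open>\<psi>\<close> says exactly that the representative picked
  inside \<open>push\<close> is immaterial for this class.\<close>

lemma push_frag_of: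
  assumes H: "subgroup H G" and y: "y \<in> H"
    and \<psi>: "\<And>k. k \<in> H \<Longrightarrow> conj_class G' (\<psi> (conj_act G k y)) = conj_class G' (\<psi> y)"
  shows "push G' \<psi> (frag_of (conj_class (G\<lparr>carrier := H\<rparr>) y)) = frag_of (conj_class G' (\<psi> y))"
proof -
  let ?c = "conj_class (G\<lparr>carrier := H\<rparr>) y"
  have conj: "conj_act (G\<lparr>carrier := H\<rparr>) k y = conj_act G k y" if "k \<in> H" for k
    using that H by (simp add: conj_act_def m_inv_consistent)
  have "y \<in> ?c"
    using group.conj_class_refl[OF subgroup.subgroup_is_group[OF H is_group]] y by simp
  then have "(SOME x. x \<in> ?c) \<in> ?c"
    by (rule someI)
  then obtain k where "k \<in> H" "(SOME x. x \<in> ?c) = conj_act G k y"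
    using conj by (auto simp: conj_class_def orbit_def)
  then show ?thesis
    using \<psi> by (simp add: push_def)
qed

end

context right_action
begin

text \<open>Composing two weighted sums multiplies the weights; the product of the two successive
  periods is the joint period of the pair, hence independent of which point is treated
  first.\<close>

lemma joint_fix_iff:
  assumes a: "a \<in> carrier G" and x: "finite (orbit G act x)" and y: "finite (orbit G act y)"
  shows "act (a [^] k) x = x \<and> act (a [^] k) y = y
    \<longleftrightarrow> period G act a x * period G act (a [^] period G act a x) y dvd k"
proof (cases "period G act a x dvd k")
  case True
  let ?d = "period G act a x"
  obtain q where q: "k = ?d * q"
    using True by auto
  have "act (a [^] k) y = y \<longleftrightarrow> act ((a [^] ?d) [^] q) y = y"
    using a by (simp add: nat_pow_pow q)
  also have "\<dots> \<longleftrightarrow> period G act (a [^] ?d) y dvd q"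
    using a y by (intro fix_iff_period_dvd) simp_all
  finally show ?thesis
    using True fix_iff_period_dvd[OF a x] period_pos[OF a x] by (simp add: q)
next
  case False
  then show ?thesis
    using fix_iff_period_dvd[OF a x] by (metis dvd_mult_left)
qed

end

section \<open>Transport of periods, classes and sublattices along a change of basis\<close>

lemma pow_intertwine:
  assumes "B ** A = A ** \<gamma>"
  shows "B [^]\<^bsub>SL2Z\<^esub> (k::nat) ** A = A ** (\<gamma> [^]\<^bsub>SL2Z\<^esub> k)"
proof (induction k)
  case (Suc k)
  have "B [^]\<^bsub>SL2Z\<^esub> Suc k ** A = B [^]\<^bsub>SL2Z\<^esub> k ** (B ** A)"
    by (simp add: matrix_mul_assoc)
  also have "\<dots> = (B [^]\<^bsub>SL2Z\<^esub> k ** A) ** \<gamma>"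
    by (simp add: assms matrix_mul_assoc)
  finally show ?case
    by (simp add: Suc matrix_mul_assoc)
qed simp

lemma det_pow [simp]: "det \<gamma> = 1 \<Longrightarrow> det (\<gamma> [^]\<^bsub>SL2Z\<^esub> (k::nat)) = 1"
  using SL2Z.nat_pow_closed[of \<gamma> k] by simp

lemma period_intertwine:
  assumes "det A \<noteq> 0" "B ** A = A ** \<gamma>"
  shows "period SL2Z lattice_act B K = period SL2Z lattice_act \<gamma> (lattice_act A K)"
proof -
  have "lattice_act (B [^]\<^bsub>SL2Z\<^esub> k) K = K
      \<longleftrightarrow> lattice_act (\<gamma> [^]\<^bsub>SL2Z\<^esub> k) (lattice_act A K) = lattice_act A K" for k :: nat
  proof -
    have "lattice_act (B [^]\<^bsub>SL2Z\<^esub> k) K = K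
        \<longleftrightarrow> lattice_act A (lattice_act (B [^]\<^bsub>SL2Z\<^esub> k) K) = lattice_act A K"
      using inj_lattice_act[OF assms(1)] by (simp add: inj_eq)
    then show ?thesis
      by (simp add: pow_intertwine[OF assms(2)] flip: lattice_act_mult)
  qed
  then show ?thesis
    by (simp add: period_def)
qed

text \<open>If \<open>C\<close> is a basis of \<open>K\<close>, then \<open>C ** A\<close> is a
  basis of its image, and one matrix \<open>B'\<close> expresses both actions in these
  bases.\<close>

lemma lattice_class_intertwine:
  assumes "det A > 0" "B ** A = A ** \<gamma>" "det B = 1" "N > 0" "K \<in> sublattices N" "lattice_act B K = K"
  shows "lattice_class K B = lattice_class (lattice_act A K) \<gamma>"
proof -
  obtain C where C: "K = lat C" "det C = int N"
    using assms(5) unfolding sublattices_eq[OF assms(4)] by blast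
  have "det C > 0" "lattice_act B (lat C) = lat C"
    using C assms by simp_all
  then obtain B' where B': "det B' = 1" "B' ** C = C ** B"
    using lat_fixE assms(3) by blast
  have "B' ** (C ** A) = C ** A ** \<gamma>"
    using B'(2) assms(2) by (metis matrix_mul_assoc)
  moreover have "det (C ** A) > 0"
    using \<open>det C > 0\<close> assms(1) by (simp add: det_mul)
  ultimately show ?thesis
    using lattice_class_eq[OF _ B'(2,1)] lattice_class_eq[of "C ** A" B' \<gamma>] B'(1) C \<open>det C > 0\<close>
    by (simp add: lattice_act_lat)
qed

text \<open>Coordinates with respect to \<open>A\<close> identify sublattices of
  \<open>lat A\<close> with sublattices of the full plane lattice, dividing the index by
  \<open>k\<close>.\<close>

lemma bij_lattice_act:
  assumes "det A = int k" "k > 0" "N > 0"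
  shows "bij_betw (lattice_act A) (sublattices N) {L \<in> sublattices (N * k). L \<subseteq> lat A}"
proof -
  have "L \<in> lattice_act A ` sublattices N" if L: "L \<in> sublattices (N * k)" "L \<subseteq> lat A" for L
  proof -
    have Nk: "N * k > 0"
      using assms by simp
    obtain B where B: "L = lat B" "det B = int (N * k)"
      using L(1) unfolding sublattices_eq[OF Nk] by blast
    then obtain C where C: "B = C ** A"
      using L(2) lat_subset_iff by blast
    then have "det C = int N"
      using B(2) assms by (simp add: det_mul)
    then have "lat C \<in> sublattices N"
      unfolding sublattices_eq[OF assms(3)] by blast
    then show ?thesis
      by (simp add: B(1) C flip: lattice_act_lat)
  qed
  moreover have "lattice_act A L \<subseteq> lat A" for L
    by (auto simp: lattice_act_def lat_def)
  moreover have "inj_on (lattice_act A) (sublattices N)"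
    by (rule inj_on_subset[OF inj_lattice_act]) (use assms in auto)
  ultimately show ?thesis
    using lattice_act_sublattices[OF assms] unfolding bij_betw_def by blast
qed

lemma sum_sublattices_act:
  assumes "det g = 1" "N > 0"
  shows "(\<Sum>M \<in> sublattices N. F (lattice_act g M)) = (\<Sum>M \<in> sublattices N. F M)"
proof -
  have "lat g = UNIV"
    using lat_mult_SL2[OF assms(1), of "mat 1"] by (simp add: lat_mat_1)
  then have "bij_betw (lattice_act g) (sublattices N) (sublattices N)"
    using bij_lattice_act[of g 1 N] assms by simp
  then show ?thesis
    by (rule sum.reindex_bij_betw)
qed

lemma conj_class_SL2Z_some:
  assumes "det a = 1"
  obtains g where "det g = 1" "(SOME x. x \<in> conj_class SL2Z a) = conj_act SL2Z g a"
proof -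
  have "a \<in> conj_class SL2Z a"
    using SL2Z.conj_class_refl assms by simp
  then have "(SOME x. x \<in> conj_class SL2Z a) \<in> conj_class SL2Z a"
    by (rule someI)
  then show thesis
    using that by (auto simp: conj_class_def orbit_def)
qed

lemma det_conj_act: "det g = 1 \<Longrightarrow> det a = 1 \<Longrightarrow> det (conj_act SL2Z g a) = 1"
  using SL2Z.inv_closed[of g] by (simp add: conj_act_def det_mul)

lemma additive_push: "additive (push G \<psi>)"
  by unfold_locales (simp add: push_def frag_extend_add)

lemma additive_pull: "additive (pull G H)"
  by unfold_locales (simp add: pull_def frag_extend_add)

lemma additive_comp: "additive f \<Longrightarrow> additive g \<Longrightarrow> additive (\<lambda>x. f (g x))"
  by (simp add: additive_def)

lemma additive_hecke: "additive (hecke N)"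
  by unfold_locales
    (simp add: hecke_def Let_def additive.add[OF additive_push] additive.add[OF additive_pull] sum.distrib)

lemma additive_e_op: "additive (e_op p)"
  by unfold_locales
    (simp add: e_op_def additive.add[OF additive_push] additive.add[OF additive_pull])

section \<open>Evaluation of the operators by additive maps\<close>

text \<open>Each orbit of sublattices contributes, through \<open>pull_class_sum\<close>, a sum over
  its own members; together the orbits exhaust all sublattices of index \<open>N\<close>.\<close>

lemma hecke_sum:
  fixes h :: "((int^2^2) set \<Rightarrow>\<^sub>0 int) \<Rightarrow> rat"
  assumes N: "N > 0" and h: "additive h" and a: "det a = 1"
  shows "h (hecke N (frag_of (conj_class SL2Z a))) =
    (\<Sum>M \<in> sublattices N. h (frag_of (lattice_class M (a [^]\<^bsub>SL2Z\<^esub> period SL2Z lattice_act a M)))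
      / of_nat (period SL2Z lattice_act a M))"
proof -
  let ?per = "period SL2Z lattice_act" and ?orb = "orbit SL2Z lattice_act"
  \<comment> \<open>The representative chosen inside \<open>pull\<close>, which is only known to be
    conjugate to \<open>a\<close>.\<close>
  define b where "b = (SOME x. x \<in> conj_class SL2Z a)"
  obtain g0 where g0: "det g0 = 1" "b = conj_act SL2Z g0 a"
    using conj_class_SL2Z_some[OF a] unfolding b_def .
  have b: "det b = 1" "b \<in> carrier SL2Z"
    using det_conj_act g0 a by simp_all
  define \<phi> where "\<phi> c M = h (frag_of (lattice_class M (c [^]\<^bsub>SL2Z\<^esub> ?per c M)))" for c M
  have orbit_term: "h (let L = (SOME L. L \<in> S) in push SL2Z (lattice_hom N L)
        (pull SL2Z (stabilizer SL2Z lattice_act L) (frag_of (conj_class SL2Z a))))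
      = (\<Sum>M \<in> {M \<in> sublattices N. ?orb M = S}. \<phi> b M / of_nat (?per b M))"
    if S: "S \<in> ?orb ` sublattices N" for S
  proof -
    define L where "L = (SOME L. L \<in> S)"
    obtain L' where L': "L' \<in> sublattices N" "S = ?orb L'"
      using S by blast
    then have "L \<in> S"
      unfolding L_def by (metis SL2Z.orbit_refl someI)
    then have L: "L \<in> sublattices N" "S = ?orb L"
      using orbit_sublattices_subset[OF N L'(1)] L'(2) SL2Z.orbit_eq by blast+
    have fiber: "{M \<in> sublattices N. ?orb M = S} = ?orb L"
      using orbit_sublattices_subset[OF N L(1)] SL2Z.orbit_eq SL2Z.orbit_refl L(2) by blast
    let ?H = "stabilizer SL2Z lattice_act L" and ?\<psi> = "lattice_hom N L"
    have cls: "conj_class SL2Z (?\<psi> \<gamma>) = lattice_class L \<gamma>" if "\<gamma> \<in> ?H" for \<gamma>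
      using lattice_class_eq[of "basis_matrix N L" "?\<psi> \<gamma>" \<gamma>] lattice_hom[OF N L(1) that]
        basis_matrix[OF N L(1)] N by simp
    have H_subgroup: "subgroup ?H SL2Z"
      by (rule SL2Z.stabilizer_subgroup)
    have push_cls: "push SL2Z ?\<psi> (frag_of (conj_class (SL2Z\<lparr>carrier := ?H\<rparr>) y)) = frag_of (lattice_class L y)"
      if y: "y \<in> ?H" for y
    proof -
      have "conj_class SL2Z (?\<psi> (conj_act SL2Z k y)) = conj_class SL2Z (?\<psi> y)" if k: "k \<in> ?H" for k
      proof -
        have "conj_act SL2Z k y \<in> ?H"
          unfolding conj_act_def using H_subgroup y k
          by (meson subgroup.m_closed subgroup.m_inv_closed)
        moreover have "lattice_class L (conj_act SL2Z k y) = lattice_class L y"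
          using lattice_class_conj_act[of k y L] y k by (simp add: stabilizer_def)
        ultimately show ?thesis
          using cls y by simp
      qed
      then show ?thesis
        using SL2Z.push_frag_of[OF H_subgroup y, of SL2Z ?\<psi>] cls[OF y] by simp
    qed
    have "h (push SL2Z ?\<psi> (pull_class SL2Z ?H b)) = (\<Sum>M \<in> ?orb L. \<phi> b M / of_nat (?per b M))"
    proof (rule SL2Z.pull_class_sum[OF b(2) finite_orbit_sublattice[OF N L(1)] additive_comp[OF h additive_push]])
      fix g assume g: "g \<in> carrier SL2Z"
      let ?d = "?per b (lattice_act g L)"
      have "lattice_act g L \<in> sublattices N"
        using g orbit_sublattices_subset[OF N L(1)] by (auto simp: orbit_def)
      then have fix_gL: "lattice_act (b [^]\<^bsub>SL2Z\<^esub> ?d) (lattice_act g L) = lattice_act g L"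
        using SL2Z.act_period[OF b(2) finite_orbit_sublattice[OF N]] by blast
      have pow: "b [^]\<^bsub>SL2Z\<^esub> ?d \<in> carrier SL2Z"
        using b by simp
      have "lattice_act (conj_act SL2Z g (b [^]\<^bsub>SL2Z\<^esub> ?d)) L = L"
        using SL2Z.act_conj_act_fix_iff[OF pow g] fix_gL by blast
      then have "conj_act SL2Z g (b [^]\<^bsub>SL2Z\<^esub> ?d) \<in> ?H"
        using det_conj_act g pow by (simp add: stabilizer_def)
      then show "h (push SL2Z ?\<psi> (frag_of (conj_class (SL2Z\<lparr>carrier := ?H\<rparr>)
          (conj_act SL2Z g (b [^]\<^bsub>SL2Z\<^esub> ?d))))) = \<phi> b (lattice_act g L)"
        using push_cls lattice_class_conj_act g pow by (simp add: \<phi>_def)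
    qed
    then show ?thesis
      by (simp add: fiber pull_def flip: L_def b_def)
  qed
  have "h (hecke N (frag_of (conj_class SL2Z a)))
      = (\<Sum>S \<in> ?orb ` sublattices N. \<Sum>M \<in> {M \<in> sublattices N. ?orb M = S}. \<phi> b M / of_nat (?per b M))"
  proof -
    have "orbits SL2Z (sublattices N) lattice_act = ?orb ` sublattices N"
      by (auto simp: orbits_def)
    then show ?thesis
      unfolding hecke_def additive.sum[OF h] using orbit_term by simp
  qed
  also have "\<dots> = (\<Sum>M \<in> sublattices N. \<phi> b M / of_nat (?per b M))"
    using sum.image_gen[OF finite_sublattices[OF N], of "\<lambda>M. \<phi> b M / of_nat (?per b M)" ?orb] by simp
  \<comment> \<open>The conjugation by \<open>g0\<close> moves from \<open>b\<close> onto the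
    lattices, where it merely permutes the index set.\<close>
  also have "\<dots> = (\<Sum>M \<in> sublattices N. \<phi> a (lattice_act g0 M) / of_nat (?per a (lattice_act g0 M)))"
    using g0 a SL2Z.conj_act_pow[of a g0] SL2Z.period_conj_act[of a g0] lattice_class_conj_act[OF g0(1)]
    by (simp add: \<phi>_def)
  also have "\<dots> = (\<Sum>M \<in> sublattices N. \<phi> a M / of_nat (?per a M))"
    by (rule sum_sublattices_act[OF g0(1) N])
  finally show ?thesis
    by (simp add: \<phi>_def)
qed

text \<open>The same computation for the single orbit of \<open>column p\<close>. Here the
  pushforward is along the inclusion, so the class of the power of \<open>a\<close> itself appears
  instead of a \<open>lattice_class\<close>.\<close>

lemma push_pull_Gamma0_sum:
  fixes h :: "((int^2^2) set \<Rightarrow>\<^sub>0 int) \<Rightarrow> rat"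
  assumes p: "prime p" and h: "additive h" and a: "det a = 1"
  shows "h (push SL2Z id (pull SL2Z (Gamma0 p) (frag_of (conj_class SL2Z a)))) =
    (\<Sum>M \<in> sublattices p. h (frag_of (conj_class SL2Z (a [^]\<^bsub>SL2Z\<^esub> period SL2Z lattice_act a M)))
      / of_nat (period SL2Z lattice_act a M))"
proof -
  let ?per = "period SL2Z lattice_act"
  let ?L = "column p" and ?H = "stabilizer SL2Z lattice_act (column p)"
  have p0: "p > 0"
    using p_pos[OF p] .
  define b where "b = (SOME x. x \<in> conj_class SL2Z a)"
  obtain g0 where g0: "det g0 = 1" "b = conj_act SL2Z g0 a"
    using conj_class_SL2Z_some[OF a] unfolding b_def .
  have b: "det b = 1" "b \<in> carrier SL2Z"
    using det_conj_act g0 a by simp_all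
  have conj_eq: "conj_class SL2Z (conj_act SL2Z g x) = conj_class SL2Z x"
    if "det g = 1" "det x = 1" for g x
    using that by (intro SL2Z.conj_class_eq) (auto simp: conj_class_def orbit_def)
  define \<phi> where "\<phi> c M = h (frag_of (conj_class SL2Z (c [^]\<^bsub>SL2Z\<^esub> ?per c M)))" for c M
  have "h (push SL2Z id (pull_class SL2Z ?H b))
      = (\<Sum>M \<in> orbit SL2Z lattice_act ?L. \<phi> b M / of_nat (?per b M))"
  proof (rule SL2Z.pull_class_sum[OF b(2) _ additive_comp[OF h additive_push]])
    show "finite (orbit SL2Z lattice_act ?L)"
      using finite_orbit_sublattice[OF p0 column_in_sublattices[OF p]] .
    fix g assume g: "g \<in> carrier SL2Z"
    let ?d = "?per b (lattice_act g ?L)"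
    have "lattice_act g ?L \<in> sublattices p"
      using g orbit_column[OF p] by (auto simp: orbit_def)
    then have fix_gL: "lattice_act (b [^]\<^bsub>SL2Z\<^esub> ?d) (lattice_act g ?L) = lattice_act g ?L"
      using SL2Z.act_period[OF b(2) finite_orbit_sublattice[OF p0]] by blast
    have pow: "b [^]\<^bsub>SL2Z\<^esub> ?d \<in> carrier SL2Z"
      using b by simp
    let ?y = "conj_act SL2Z g (b [^]\<^bsub>SL2Z\<^esub> ?d)"
    have "lattice_act ?y ?L = ?L"
      unfolding SL2Z.act_conj_act_fix_iff[OF pow g] by (rule fix_gL)
    moreover have y: "det ?y = 1"
      using det_conj_act g pow by simp
    ultimately have "?y \<in> ?H"
      by (simp add: stabilizer_def)
    then have "push SL2Z id (frag_of (conj_class (SL2Z\<lparr>carrier := ?H\<rparr>) ?y)) = frag_of (conj_class SL2Z (id ?y))"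
      by (rule SL2Z.push_frag_of[OF SL2Z.stabilizer_subgroup])
        (use conj_eq y in \<open>simp add: stabilizer_def\<close>)
    then show "h (push SL2Z id (frag_of (conj_class (SL2Z\<lparr>carrier := ?H\<rparr>) ?y))) = \<phi> b (lattice_act g ?L)"
      using conj_eq g pow by (simp add: \<phi>_def)
  qed
  then have "h (push SL2Z id (pull SL2Z (Gamma0 p) (frag_of (conj_class SL2Z a))))
      = (\<Sum>M \<in> sublattices p. \<phi> b M / of_nat (?per b M))"
    by (simp add: pull_def orbit_column[OF p] stabilizer_column[OF p0] flip: b_def)
  also have "\<dots> = (\<Sum>M \<in> sublattices p. \<phi> a (lattice_act g0 M) / of_nat (?per a (lattice_act g0 M)))"
    using g0 a SL2Z.conj_act_pow[of a g0] SL2Z.period_conj_act[of a g0] conj_eq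
    by (simp add: \<phi>_def)
  also have "\<dots> = (\<Sum>M \<in> sublattices p. \<phi> a M / of_nat (?per a M))"
    by (rule sum_sublattices_act[OF g0(1) p0])
  finally show ?thesis
    by (simp add: \<phi>_def)
qed

text \<open>Describes the outer operator of a composite: in coordinates of a basis of
  \<open>M\<close> it is \<open>hecke_sum\<close>, and transporting back gives a sum over
  sublattices of \<open>M\<close>.\<close>

lemma hecke_lattice_class_sum:
  fixes h :: "((int^2^2) set \<Rightarrow>\<^sub>0 int) \<Rightarrow> rat"
  assumes k: "k > 0" and N: "N > 0" and h: "additive h" and M: "M \<in> sublattices k"
    and \<gamma>: "det \<gamma> = 1" "lattice_act \<gamma> M = M"
  shows "h (hecke N (frag_of (lattice_class M \<gamma>))) =
    (\<Sum>L \<in> {L \<in> sublattices (N * k). L \<subseteq> M}.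
       h (frag_of (lattice_class L (\<gamma> [^]\<^bsub>SL2Z\<^esub> period SL2Z lattice_act \<gamma> L)))
         / of_nat (period SL2Z lattice_act \<gamma> L))"
proof -
  let ?per = "period SL2Z lattice_act"
  obtain A where A: "M = lat A" "det A = int k"
    using M unfolding sublattices_eq[OF k] by blast
  then have A0: "det A > 0" "det A \<noteq> 0"
    using k by simp_all
  obtain B where B: "det B = 1" "B ** A = A ** \<gamma>"
    using lat_fixE[OF A0(1) \<gamma>(1)] \<gamma>(2) A(1) by blast
  have "h (hecke N (frag_of (lattice_class M \<gamma>))) = (\<Sum>K \<in> sublattices N.
      h (frag_of (lattice_class K (B [^]\<^bsub>SL2Z\<^esub> ?per B K))) / of_nat (?per B K))"
    using hecke_sum[OF N h B(1)] lattice_class_eq[OF A0(1) B(2,1)] A(1) by simp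
  also have "\<dots> = (\<Sum>K \<in> sublattices N.
      h (frag_of (lattice_class (lattice_act A K) (\<gamma> [^]\<^bsub>SL2Z\<^esub> ?per \<gamma> (lattice_act A K))))
        / of_nat (?per \<gamma> (lattice_act A K)))"
  proof (rule sum.cong)
    fix K assume K: "K \<in> sublattices N"
    have "lattice_act (B [^]\<^bsub>SL2Z\<^esub> ?per B K) K = K"
      using SL2Z.act_period[OF _ finite_orbit_sublattice[OF N K]] B(1) by simp
    then have "lattice_class K (B [^]\<^bsub>SL2Z\<^esub> ?per B K)
        = lattice_class (lattice_act A K) (\<gamma> [^]\<^bsub>SL2Z\<^esub> ?per B K)"
      using lattice_class_intertwine[OF A0(1) pow_intertwine[OF B(2)] _ N K] B(1) by simp
    then show "h (frag_of (lattice_class K (B [^]\<^bsub>SL2Z\<^esub> ?per B K))) / of_nat (?per B K) =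
        h (frag_of (lattice_class (lattice_act A K) (\<gamma> [^]\<^bsub>SL2Z\<^esub> ?per \<gamma> (lattice_act A K))))
        / of_nat (?per \<gamma> (lattice_act A K))"
      using period_intertwine[OF A0(2) B(2)] by simp
  qed simp
  also have "\<dots> = (\<Sum>L \<in> {L \<in> sublattices (N * k). L \<subseteq> M}.
       h (frag_of (lattice_class L (\<gamma> [^]\<^bsub>SL2Z\<^esub> ?per \<gamma> L))) / of_nat (?per \<gamma> L))"
    unfolding A(1) by (rule sum.reindex_bij_betw[OF bij_lattice_act[OF A(2) k N]])
  finally show ?thesis .
qed

section \<open>The recursion on a single conjugacy class\<close>

lemma hecke_recursion_frag_of:
  fixes h :: "((int^2^2) set \<Rightarrow>\<^sub>0 int) \<Rightarrow> rat"
  assumes p: "prime p" and h: "additive h" and a: "det a = 1"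
  shows "h (hecke (p ^ Suc n) (hecke p (frag_of (conj_class SL2Z a))))
    = h (hecke (p ^ Suc (Suc n)) (frag_of (conj_class SL2Z a)))
      + h (hecke (p ^ n) (e_op p (frag_of (conj_class SL2Z a))))"
proof -
  let ?per = "period SL2Z lattice_act"
  let ?x = "frag_of (conj_class SL2Z a)"
  let ?sub = "sublattices (p ^ Suc (Suc n))" and ?subp = "sublattices p" and ?subn = "sublattices (p ^ n)"
  have p0: "p > 0" "p ^ n > 0" "p ^ Suc n > 0" "p ^ Suc (Suc n) > 0"
    using p_pos[OF p] by simp_all
  have aG: "a \<in> carrier SL2Z"
    using a by simp
  define d where "d M = ?per a M" for M
  \<comment> \<open>The joint period of the flag under \<open>a\<close>; \<open>joint\<close> below
    characterizes it symmetrically in \<open>M\<close> and \<open>L\<close>.\<close>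
  define D where "D M L = d M * ?per (a [^]\<^bsub>SL2Z\<^esub> d M) L" for M L
  define \<phi> where "\<phi> L k = h (frag_of (lattice_class L (a [^]\<^bsub>SL2Z\<^esub> k))) / of_nat k" for L and k :: nat
  have joint: "lattice_act (a [^]\<^bsub>SL2Z\<^esub> k) M = M \<and> lattice_act (a [^]\<^bsub>SL2Z\<^esub> k) L = L \<longleftrightarrow> D M L dvd k"
    if "M \<in> ?subp" "L \<in> sublattices j" "j > 0" for M L j k
    using SL2Z.joint_fix_iff[OF aG finite_orbit_sublattice[OF p0(1) that(1)]
        finite_orbit_sublattice[OF that(3,2)]] by (simp add: D_def d_def)
  \<comment> \<open>Lattices inside \<open>scaled p\<close> are the multiples \<open>p K\<close>.
    Scaling by \<open>p\<close> has determinant \<open>p * p\<close>, so \<open>K\<close> has index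
    \<open>p ^ n\<close>.\<close>
  have sum_split: "(\<Sum>L \<in> ?sub. F L) = (\<Sum>L \<in> {L \<in> ?sub. \<not> L \<subseteq> scaled p}. F L)
      + (\<Sum>K \<in> ?subn. F (lattice_act (mat (int p)) K))" for F :: "(int^2) set \<Rightarrow> rat"
  proof -
    have "p ^ Suc (Suc n) = p ^ n * (p * p)"
      by simp
    then have "{L \<in> ?sub. L \<subseteq> scaled p} = {L \<in> sublattices (p ^ n * (p * p)). L \<subseteq> lat (mat (int p))}"
      by (simp only: lat_mat)
    then have "bij_betw (lattice_act (mat (int p))) ?subn {L \<in> ?sub. L \<subseteq> scaled p}"
      using bij_lattice_act[of "mat (int p)" "p * p" "p ^ n"] p0 by (simp add: det_mat_2)
    then have "(\<Sum>K \<in> ?subn. F (lattice_act (mat (int p)) K)) = (\<Sum>L \<in> {L \<in> ?sub. L \<subseteq> scaled p}. F L)"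
      by (rule sum.reindex_bij_betw)
    moreover have "(\<Sum>L \<in> ?sub. F L) = (\<Sum>L \<in> {L \<in> ?sub. \<not> L \<subseteq> scaled p} \<union> {L \<in> ?sub. L \<subseteq> scaled p}. F L)"
      by (rule sum.cong) auto
    moreover have "\<dots> = (\<Sum>L \<in> {L \<in> ?sub. \<not> L \<subseteq> scaled p}. F L) + (\<Sum>L \<in> {L \<in> ?sub. L \<subseteq> scaled p}. F L)"
      using finite_sublattices[OF p0(4)] by (intro sum.union_disjoint) auto
    ultimately show ?thesis by simp
  qed
  \<comment> \<open>Scalar matrices commute with everything, so scaling a lattice changes neither
    its period nor its class.\<close>
  have scale: "?per c (lattice_act (mat (int p)) K) = ?per c K"
    "lattice_act c K = K \<Longrightarrow> lattice_class (lattice_act (mat (int p)) K) c = lattice_class K c"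
    if "det c = 1" "K \<in> ?subn" for c K
  proof -
    have comm: "c ** mat (int p) = mat (int p) ** c"
      by (simp add: coords_2)
    have "det (mat (int p) :: int^2^2) > 0"
      using p0 by (simp add: det_mat_2)
    then show "?per c (lattice_act (mat (int p)) K) = ?per c K"
      "lattice_act c K = K \<Longrightarrow> lattice_class (lattice_act (mat (int p)) K) c = lattice_class K c"
      using period_intertwine[OF _ comm, of K] lattice_class_intertwine[OF _ comm that(1) p0(2) that(2)]
      by simp_all
  qed
  \<comment> \<open>The joint period divides itself, so \<open>joint\<close> shows that this power
    of \<open>a\<close> fixes \<open>K\<close>, as the second part of \<open>scale\<close>
    demands.\<close>
  have pK: "D M (lattice_act (mat (int p)) K) = D M K"
      "\<phi> (lattice_act (mat (int p)) K) (D M K) = \<phi> K (D M K)"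
    if "M \<in> ?subp" "K \<in> ?subn" for M K
    using scale[OF _ that(2)] a joint[OF that p0(2), of "D M K"] by (simp_all add: D_def \<phi>_def)

  have "h (hecke (p ^ Suc n) (hecke p ?x)) = (\<Sum>M \<in> ?subp. \<Sum>L \<in> {L \<in> ?sub. L \<subseteq> M}. \<phi> L (D M L))"
  proof -
    have "h (hecke (p ^ Suc n) (frag_of (lattice_class M (a [^]\<^bsub>SL2Z\<^esub> d M)))) / of_nat (d M)
        = (\<Sum>L \<in> {L \<in> ?sub. L \<subseteq> M}. \<phi> L (D M L))" if M: "M \<in> ?subp" for M
    proof -
      have "lattice_act (a [^]\<^bsub>SL2Z\<^esub> d M) M = M"
        unfolding d_def by (rule SL2Z.act_period[OF aG finite_orbit_sublattice[OF p0(1) M]])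
      then have "h (hecke (p ^ Suc n) (frag_of (lattice_class M (a [^]\<^bsub>SL2Z\<^esub> d M))))
        = (\<Sum>L \<in> {L \<in> sublattices (p ^ Suc n * p). L \<subseteq> M}.
             h (frag_of (lattice_class L ((a [^]\<^bsub>SL2Z\<^esub> d M) [^]\<^bsub>SL2Z\<^esub> ?per (a [^]\<^bsub>SL2Z\<^esub> d M) L)))
               / of_nat (?per (a [^]\<^bsub>SL2Z\<^esub> d M) L))"
        using hecke_lattice_class_sum[OF p0(1,3) h M] a by simp
      moreover have "p ^ Suc n * p = p ^ Suc (Suc n)"
        by simp
      ultimately show ?thesis
        by (simp only: sum_divide_distrib \<phi>_def D_def SL2Z.nat_pow_pow[OF aG] divide_divide_eq_left
            of_nat_mult mult.commute)
    qed
    then show ?thesis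
      using hecke_sum[OF p0(1) additive_comp[OF h additive_hecke] a, of "p ^ Suc n"]
      by (simp flip: d_def)
  qed
  also have "\<dots> = (\<Sum>L \<in> ?sub. \<Sum>M \<in> {M \<in> ?subp. L \<subseteq> M}. \<phi> L (D M L))"
    by (rule sum.swap_restrict[OF finite_sublattices[OF p0(1)] finite_sublattices[OF p0(4)]])
  \<comment> \<open>The inner sum has a single term when \<open>L\<close> is not inside
    \<open>scaled p\<close>, and runs over all lattices of index \<open>p\<close> when it
    is.\<close>
  also have "\<dots> = (\<Sum>L \<in> {L \<in> ?sub. \<not> L \<subseteq> scaled p}. \<phi> L (d L)) + (\<Sum>K \<in> ?subn. \<Sum>M \<in> ?subp. \<phi> K (D M K))"
  proof -
    have "(\<Sum>M \<in> {M \<in> ?subp. L \<subseteq> M}. \<phi> L (D M L)) = \<phi> L (d L)"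
      if L: "L \<in> {L \<in> ?sub. \<not> L \<subseteq> scaled p}" for L
    proof -
      obtain M where M: "{M \<in> ?subp. L \<subseteq> M} = {M}"
        using prime_superlattice_unique[OF p, of L "Suc n"] L by blast
      then have M': "M \<in> ?subp" "L \<subseteq> M"
        by blast+
      \<comment> \<open>A power of \<open>a\<close> fixing \<open>L\<close> sends \<open>M\<close>
        to another index \<open>p\<close> lattice above \<open>L\<close>, which must be
        \<open>M\<close> by uniqueness; so the joint period is that of \<open>L\<close>.\<close>
      have "D M L = d L"
      proof -
        have "lattice_act (a [^]\<^bsub>SL2Z\<^esub> k) M = M" if "lattice_act (a [^]\<^bsub>SL2Z\<^esub> k) L = L" for k :: nat
        proof -
          have "lattice_act (a [^]\<^bsub>SL2Z\<^esub> k) M \<in> ?subp"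
            using lattice_act_sublattices[of "a [^]\<^bsub>SL2Z\<^esub> k" 1 p M] a M' p0 by simp
          moreover have "L \<subseteq> lattice_act (a [^]\<^bsub>SL2Z\<^esub> k) M"
            using M'(2) that unfolding lattice_act_def by blast
          ultimately show ?thesis
            using M by blast
        qed
        then have "lattice_act (a [^]\<^bsub>SL2Z\<^esub> k) L = L \<longleftrightarrow> D M L dvd k" for k :: nat
          using joint[OF M'(1) _ p0(4)] L by blast
        then show ?thesis
          unfolding d_def using SL2Z.period_eqI[OF aG finite_orbit_sublattice[OF p0(4)]] L by simp
      qed
      then show ?thesis
        by (simp add: M)
    qed
    moreover have "(\<Sum>M \<in> {M \<in> ?subp. lattice_act (mat (int p)) K \<subseteq> M}.
        \<phi> (lattice_act (mat (int p)) K) (D M (lattice_act (mat (int p)) K))) = (\<Sum>M \<in> ?subp. \<phi> K (D M K))"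
      if K: "K \<in> ?subn" for K
    proof -
      have "lattice_act (mat (int p)) K \<subseteq> scaled p"
        unfolding lat_mat[symmetric] by (auto simp: lattice_act_def lat_def)
      then have "{M \<in> ?subp. lattice_act (mat (int p)) K \<subseteq> M} = ?subp"
        using scaled_subset_sublattice[OF p0(1)] by blast
      then show ?thesis
        using pK K by simp
    qed
    ultimately show ?thesis
      by (simp only: sum_split cong: sum.cong)
  qed
  finally have lhs: "h (hecke (p ^ Suc n) (hecke p ?x)) = \<dots>" .

  have hecke_x: "h (hecke N ?x) = (\<Sum>L \<in> sublattices N. \<phi> L (d L))" if "N > 0" for N
    using hecke_sum[OF that h a] by (simp add: \<phi>_def d_def)
  have "\<phi> (lattice_act (mat (int p)) K) (d (lattice_act (mat (int p)) K)) = \<phi> K (d K)" if K: "K \<in> ?subn" for K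
    using scale[OF _ K] a SL2Z.act_period[OF aG finite_orbit_sublattice[OF p0(2) K]]
    by (simp add: \<phi>_def d_def)
  then have T: "h (hecke (p ^ Suc (Suc n)) ?x)
      = (\<Sum>L \<in> {L \<in> ?sub. \<not> L \<subseteq> scaled p}. \<phi> L (d L)) + h (hecke (p ^ n) ?x)"
    by (simp only: hecke_x[OF p0(4)] hecke_x[OF p0(2)] sum_split cong: sum.cong)

  \<comment> \<open>Here \<open>K\<close> and \<open>M\<close> range independently, with no
    inclusion between them: the same double sum as the one produced above by the lattices
    \<open>p K\<close>.\<close>
  have "h (hecke (p ^ n) (push SL2Z id (pull SL2Z (Gamma0 p) ?x)))
      = (\<Sum>M \<in> ?subp. \<Sum>K \<in> ?subn. \<phi> K (D M K))"
  proof -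
    have "h (hecke (p ^ n) (frag_of (conj_class SL2Z (a [^]\<^bsub>SL2Z\<^esub> d M)))) / of_nat (d M)
        = (\<Sum>K \<in> ?subn. \<phi> K (D M K))" for M
      using hecke_sum[OF p0(2) h, of "a [^]\<^bsub>SL2Z\<^esub> d M"] a
      by (simp add: sum_divide_distrib \<phi>_def D_def SL2Z.nat_pow_pow mult.commute)
    then show ?thesis
      using push_pull_Gamma0_sum[OF p additive_comp[OF h additive_hecke] a, of "p ^ n"]
      by (simp flip: d_def)
  qed
  also have "\<dots> = (\<Sum>K \<in> ?subn. \<Sum>M \<in> ?subp. \<phi> K (D M K))"
    by (rule sum.swap)
  \<comment> \<open>The subtracted identity in \<open>e_op\<close> cancels the single count of the
    lattices \<open>p K\<close> in \<open>T\<close>.\<close>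
  finally have "h (hecke (p ^ n) (e_op p ?x)) = (\<Sum>K \<in> ?subn. \<Sum>M \<in> ?subp. \<phi> K (D M K)) - h (hecke (p ^ n) ?x)"
    by (simp add: e_op_def additive.diff[OF additive_comp[OF h additive_hecke]])
  then show ?thesis
    using lhs T by simp
qed

theorem theorem2:
  fixes p n :: nat
  assumes "prime p" and "n \<ge> 1"
  shows "\<forall>x \<in> carrier (free_Abelian_group (conj_classes SL2Z)).
    (hecke (p ^ n) \<circ> hecke p) x = hecke (p ^ (n + 1)) x + (hecke (p ^ (n - 1)) \<circ> e_op p) x"
proof
  obtain m where n: "n = Suc m"
    using assms(2) by (cases n) auto
  fix x assume "x \<in> carrier (free_Abelian_group (conj_classes SL2Z))"
  then have "Poly_Mapping.keys x \<subseteq> conj_classes SL2Z"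
    by (simp add: carrier_free_Abelian_group_iff)
  then have "hecke (p ^ Suc m) (hecke p x) = hecke (p ^ Suc (Suc m)) x + hecke (p ^ m) (e_op p x)"
  proof (induction x rule: frag_induction)
    case zero
    show ?case
      by (simp add: additive.zero[OF additive_hecke] additive.zero[OF additive_e_op])
  next
    case (one C)
    then obtain a where a: "det a = 1" "C = conj_class SL2Z a"
      by (auto simp: conj_classes_def orbits_def conj_class_def)
    \<comment> \<open>Coefficients at all classes are additive maps to the rationals and together
      separate elements, so the evaluated identity yields the identity itself.\<close>
    have "additive (\<lambda>x. rat_of_int (Poly_Mapping.lookup x c))" for c :: "(int^2^2) set"
      by unfold_locales (simp add: lookup_add)
    from hecke_recursion_frag_of[OF assms(1) this a(1)] show ?case
      by (intro poly_mapping_eqI) (simp add: lookup_add a(2) flip: of_int_add)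
  next
    case (diff x y)
    then show ?case
      by (simp add: additive.diff[OF additive_hecke] additive.diff[OF additive_e_op])
  qed
  then show "(hecke (p ^ n) \<circ> hecke p) x = hecke (p ^ (n + 1)) x + (hecke (p ^ (n - 1)) \<circ> e_op p) x"
    by (simp add: n)
qed

end
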